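(* Let $T=(V,E)$ be a rooted tree with $n$ leaves such that each inner node has degree at least three, and let $\hat p\in\mathcal{M}_T$ be such that each observed variable $X_i$ is non-degenerate under $\hat p$. Let $\widehat E$ be the set of edges isolated relative to $\hat p$ and $\widehat T$ the $\hat p$-forest. Suppose that every inner node of $T$ has degree at least three in $\widehat T$. Then every point $((\bar\mu_v)_{v\in V},(\eta_{u,v})_{(u,v)\in E})$ in the $\hat p$-fiber satisfies the following. (a) $\bar\mu_i=1-2\hat\lambda_i$ for all $i=1,\ldots,n$, and $\eta_{u,v}=0$ for all $(u,v)\in\widehat E$. (b) For any inner node $v$ of $T$, if $i,j,k\in[n]$ are any three leaves separated by $v$ in $T$ such that $\hat\mu_{ij}\hat\mu_{ik}\hat\mu_{jk}\neq0$, then $$\bar\mu_v^2=\frac{\hat\mu_{ijk}^2}{\hat\mu_{ijk}^2+4\hat\mu_{ij}\hat\mu_{ik}\hat\mu_{jk}}.$$ (c) For any terminal edge $(v,i)\in E\setminus\widehat E$, where $v$ is an inner node and $i\in[n]$ is a leaf of $T$, let $j,k$ be any two leaves such that $v$ separates $i,j,k$ and $\hat\mu_{jk}\ne0$. Then $$\eta_{v,i}^2=\frac{\hat\mu_{ijk}^2+4\hat\mu_{ij}\hat\mu_{ik}\hat\mu_{jk}}{\hat\mu_{jk}^2}.$$ (d) For any inner edge $(u,v)\in E\setminus\widehat E$ let $i,j,k,l\in[n]$ be any four leaves of $T$ such that $u$ separates $i$ and $j$ in $\widehat T$, $v$ separates $k$ and $l$ in $\widehat T$, and $(u,v)$ separates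 $\{i,j\}$ from $\{k,l\}$ in $\widehat T$. Then $$\eta_{u,v}^2=\frac{\hat\mu_{il}^2}{\hat\mu_{ij}^2}\cdot\frac{\hat\mu_{ijk}^2+4\hat\mu_{ij}\hat\mu_{ik}\hat\mu_{jk}}{\hat\mu_{ikl}^2+4\hat\mu_{ik}\hat\mu_{il}\hat\mu_{kl}}.$$
   Context: Trees. A leaf is a node of degree one; other nodes are inner; an edge is inner if both its ends are inner nodes. $T=(V,E)$ has a root $r$ and all edges are directed away from $r$; $\mathrm{pa}(v)$ is the parent of $v$. The leaves are identified with $[n]=\{1,\ldots,n\}$. $E(ij)$ is the set of edges on the path between nodes $i$ and $j$. A node (edge) separates given leaves in a tree or forest if those leaves lie in the same connected component and every path between any two of them (respectively, between the two given groups) passes through that node (edge). Model. All variables $Y_v$, $v\in V$, are binary with values in $\{0,1\}$; $X=(X_1,\ldots,X_n)$ is the subvector at the leaves. $\Theta_T=[0,1]^{2|E|+1}$ has free parameters $\theta^{(r)}_1=P(Y_r=1)$ and $\theta^{(v)}_{1|i}=P(Y_v=1\mid Y_u=i)$ for $(u,v)\in E$, $i\in\{0,1\}$ (with $\theta^{(r)}_0=1-\theta^{(r)}_1$, $\theta^{(v)}_{0|i}=1-\theta^{(v)}_{1|i}$). The map $f_T:\Theta_T\to\Delta_{2^n-1}$ into the simplex of probability distributions on $\{0,1\}^n$ is $p_\beta(\theta)=\sum_{\alpha}\prod_{v\in V}\theta^{(v)}_{\alpha_v|\alpha_{\mathrm{pa}(v)}}$, the sum being over all $\alpha\in\{0,1\}^V$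 whose restriction to the leaves is $\beta$. $\mathcal{M}_T=f_T(\Theta_T)$. Fiber. The $\hat p$-fiber is $f_T^{-1}(\hat p)\subseteq\Theta_T$, viewed through the polynomial isomorphism $\theta\mapsto((\bar\mu_v)_{v\in V},(\eta_{u,v})_{(u,v)\in E})$, where $\bar\mu_v=1-2E(Y_v)$ and $\eta_{u,v}=\theta^{(v)}_{1|1}-\theta^{(v)}_{1|0}$. Moments and $\hat p$-forest. Let $\hat\lambda_i=E_{\hat p}(X_i)$, $\hat\mu_{ij}=E_{\hat p}[(X_i-\hat\lambda_i)(X_j-\hat\lambda_j)]$, $\hat\mu_{ijk}=E_{\hat p}[(X_i-\hat\lambda_i)(X_j-\hat\lambda_j)(X_k-\hat\lambda_k)]$. It is always assumed that $\hat\lambda_i(1-\hat\lambda_i)\ne0$ for all $i\in[n]$. An edge $e\in E$ is isolated relative to $\hat p$ if $\hat\mu_{ij}=0$ for all distinct $i,j\in[n]$ such that $e\in E(ij)$. $\widehat E\subseteq E$ is the set of isolated edges, and $\widehat T=T\setminus\widehat E$ is the forest with node set $V$ and edge set $E\setminus\widehat E$. *)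

theory Defs
  imports Complex_Main "HOL-Library.FuncSet"
    "Graph_Theory.Pair_Digraph" "Graph_Theory.Vertex_Walk" "Graph_Theory.Digraph_Component"
begin

section \<open>Rooted trees\<close>

text \<open>
  A rooted tree is a digraph on nodes of type \<open>nat\<close> together with a root.  Paths, degrees,
  leaves and separation refer to the underlying undirected graph, which is \<open>mk_symmetric\<close> of the
  digraph.  A path is given by its list of (distinct) nodes.
\<close>

definition upath :: "nat pair_pre_digraph \<Rightarrow> nat \<Rightarrow> nat list \<Rightarrow> nat \<Rightarrow> bool" where
  "upath G a p b \<longleftrightarrow>
     vpath p (with_proj (mk_symmetric (with_proj G))) \<and> hd p = a \<and> last p = b"

definition traverses :: "nat list \<Rightarrow> nat \<times> nat \<Rightarrow> bool" where
  "traverses p e \<longleftrightarrow>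
     (fst e, snd e) \<in> set (vwalk_arcs p) \<or> (snd e, fst e) \<in> set (vwalk_arcs p)"

definition ucycle :: "nat pair_pre_digraph \<Rightarrow> nat list \<Rightarrow> bool" where
  "ucycle G p \<longleftrightarrow> 3 \<le> length p \<and> vpath p (with_proj (mk_symmetric (with_proj G))) \<and>
     (last p, hd p) \<in> parcs (mk_symmetric (with_proj G))"

text \<open>
  The predicate \<open>Digraph_Component.tree\<close> of the library only excludes \<^emph>\<open>directed\<close> cycles, hence the
  explicit condition on cycles of the underlying undirected graph.  The last condition says that
  every edge \<open>(u, v)\<close> is directed away from the root: it is traversed from \<open>u\<close> to \<open>v\<close> by a path that
  starts in the root.
\<close>

definition rooted_tree :: "nat pair_pre_digraph \<Rightarrow> nat \<Rightarrow> bool" where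
  "rooted_tree T r \<longleftrightarrow>
     pair_digraph T \<and> (\<forall>u v. (u, v) \<in> parcs T \<longrightarrow> (v, u) \<notin> parcs T) \<and>
     Digraph_Component.connected (with_proj T) \<and> (\<nexists>p. ucycle T p) \<and>
     r \<in> pverts T \<and>
     (\<forall>u v. (u, v) \<in> parcs T \<longrightarrow> (\<exists>p. upath T r p v \<and> (u, v) \<in> set (vwalk_arcs p)))"

definition udegree :: "nat pair_pre_digraph \<Rightarrow> nat \<Rightarrow> nat" where
  "udegree G v = out_degree (with_proj (mk_symmetric (with_proj G))) v"

definition leaves :: "nat pair_pre_digraph \<Rightarrow> nat set" where
  "leaves G = {v \<in> pverts G. udegree G v = 1}"

definition inner_nodes :: "nat pair_pre_digraph \<Rightarrow> nat set" where
  "inner_nodes G = pverts G - leaves G"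

definition parent :: "nat pair_pre_digraph \<Rightarrow> nat \<Rightarrow> nat" where
  "parent T v = (THE u. (u, v) \<in> parcs T)"

definition path_edges :: "nat pair_pre_digraph \<Rightarrow> nat \<Rightarrow> nat \<Rightarrow> (nat \<times> nat) set" where
  "path_edges T i j = {e \<in> parcs T. \<exists>p. upath T i p j \<and> traverses p e}"

definition same_component :: "nat pair_pre_digraph \<Rightarrow> nat set \<Rightarrow> bool" where
  "same_component G S \<longleftrightarrow> (\<forall>a\<in>S. \<forall>b\<in>S. \<exists>p. upath G a p b)"

definition node_separates :: "nat pair_pre_digraph \<Rightarrow> nat \<Rightarrow> nat set \<Rightarrow> bool" where
  "node_separates G v S \<longleftrightarrow> same_component G S \<and>
     (\<forall>a\<in>S. \<forall>b\<in>S. a \<noteq> b \<longrightarrow> (\<forall>p. upath G a p b \<longrightarrow> v \<in> set p))"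

definition edge_separates ::
    "nat pair_pre_digraph \<Rightarrow> nat \<times> nat \<Rightarrow> nat set \<Rightarrow> nat set \<Rightarrow> bool" where
  "edge_separates G e A B \<longleftrightarrow> same_component G (A \<union> B) \<and>
     (\<forall>a\<in>A. \<forall>b\<in>B. \<forall>p. upath G a p b \<longrightarrow> traverses p e)"


section \<open>The model\<close>

text \<open>
  A parameter vector is a pair: the first component is \<open>\<theta>\<^sup>(\<^sup>r\<^sup>)\<^sub>1\<close>, and the second component maps
  \<open>((u, v), i)\<close>, for an edge \<open>(u, v)\<close> and \<open>i \<in> {0, 1}\<close>, to \<open>\<theta>\<^sup>(\<^sup>v\<^sup>)\<^sub>1\<^sub>|\<^sub>i\<close>.
\<close>

type_synonym params = "real \<times> ((nat \<times> nat) \<times> nat \<Rightarrow> real)"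

abbreviation cube :: "nat set \<Rightarrow> (nat \<Rightarrow> nat) set" where
  "cube I \<equiv> I \<rightarrow>\<^sub>E {0, 1}"

definition Theta :: "nat pair_pre_digraph \<Rightarrow> params set" where
  "Theta T = {0..1} \<times> ((parcs T \<times> {0, 1}) \<rightarrow>\<^sub>E {0..1})"

text \<open>\<open>cond_prob T r \<theta> v a b\<close> is \<open>\<theta>\<^sup>(\<^sup>v\<^sup>)\<^sub>a\<^sub>|\<^sub>b\<close>; for the root the conditioning value \<open>b\<close> is ignored.\<close>

definition cond_prob ::
    "nat pair_pre_digraph \<Rightarrow> nat \<Rightarrow> params \<Rightarrow> nat \<Rightarrow> nat \<Rightarrow> nat \<Rightarrow> real" where
  "cond_prob T r \<theta> v a b =
     (let t = (if v = r then fst \<theta> else snd \<theta> ((parent T v, v), b))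
      in if a = 1 then t else 1 - t)"

definition joint_prob ::
    "nat pair_pre_digraph \<Rightarrow> nat \<Rightarrow> params \<Rightarrow> (nat \<Rightarrow> nat) \<Rightarrow> real" where
  "joint_prob T r \<theta> \<alpha> = (\<Prod>v\<in>pverts T. cond_prob T r \<theta> v (\<alpha> v) (\<alpha> (parent T v)))"

definition model_map ::
    "nat pair_pre_digraph \<Rightarrow> nat \<Rightarrow> params \<Rightarrow> (nat \<Rightarrow> nat) \<Rightarrow> real" where
  "model_map T r \<theta> =
     (\<lambda>\<beta>\<in>cube (leaves T).
        \<Sum>\<alpha> | \<alpha> \<in> cube (pverts T) \<and> restrict \<alpha> (leaves T) = \<beta>. joint_prob T r \<theta> \<alpha>)"

definition model :: "nat pair_pre_digraph \<Rightarrow> nat \<Rightarrow> ((nat \<Rightarrow> nat) \<Rightarrow> real) set" where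
  "model T r = model_map T r ` Theta T"

definition node_mean :: "nat pair_pre_digraph \<Rightarrow> nat \<Rightarrow> params \<Rightarrow> nat \<Rightarrow> real" where
  "node_mean T r \<theta> v = (\<Sum>\<alpha>\<in>cube (pverts T). joint_prob T r \<theta> \<alpha> * real (\<alpha> v))"

text \<open>The new coordinates \<open>((\<mu>\<^sub>v)\<^sub>v, (\<eta>\<^sub>u\<^sub>v)\<^sub>u\<^sub>v)\<close> on the parameter space.\<close>

definition coords ::
    "nat pair_pre_digraph \<Rightarrow> nat \<Rightarrow> params \<Rightarrow> (nat \<Rightarrow> real) \<times> (nat \<times> nat \<Rightarrow> real)" where
  "coords T r \<theta> =
     (\<lambda>v\<in>pverts T. 1 - 2 * node_mean T r \<theta> v,
      \<lambda>e\<in>parcs T. snd \<theta> (e, 1) - snd \<theta> (e, 0))"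

definition fiber ::
    "nat pair_pre_digraph \<Rightarrow> nat \<Rightarrow> ((nat \<Rightarrow> nat) \<Rightarrow> real) \<Rightarrow> params set" where
  "fiber T r p = {\<theta> \<in> Theta T. model_map T r \<theta> = p}"


section \<open>Moments of a distribution on the cube and the forest of non-isolated edges\<close>

definition expect :: "nat \<Rightarrow> ((nat \<Rightarrow> nat) \<Rightarrow> real) \<Rightarrow> ((nat \<Rightarrow> nat) \<Rightarrow> real) \<Rightarrow> real" where
  "expect n p g = (\<Sum>x\<in>cube {1..n}. p x * g x)"

definition lam :: "nat \<Rightarrow> ((nat \<Rightarrow> nat) \<Rightarrow> real) \<Rightarrow> nat \<Rightarrow> real" where
  "lam n p i = expect n p (\<lambda>x. real (x i))"

definition mu2 :: "nat \<Rightarrow> ((nat \<Rightarrow> nat) \<Rightarrow> real) \<Rightarrow> nat \<Rightarrow> nat \<Rightarrow> real" where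
  "mu2 n p i j = expect n p (\<lambda>x. (real (x i) - lam n p i) * (real (x j) - lam n p j))"

definition mu3 :: "nat \<Rightarrow> ((nat \<Rightarrow> nat) \<Rightarrow> real) \<Rightarrow> nat \<Rightarrow> nat \<Rightarrow> nat \<Rightarrow> real" where
  "mu3 n p i j k = expect n p (\<lambda>x.
     (real (x i) - lam n p i) * (real (x j) - lam n p j) * (real (x k) - lam n p k))"

definition isolated_edges ::
    "nat pair_pre_digraph \<Rightarrow> nat \<Rightarrow> ((nat \<Rightarrow> nat) \<Rightarrow> real) \<Rightarrow> (nat \<times> nat) set" where
  "isolated_edges T n p = {e \<in> parcs T.
     \<forall>i\<in>{1..n}. \<forall>j\<in>{1..n}. i \<noteq> j \<and> e \<in> path_edges T i j \<longrightarrow> mu2 n p i j = 0}"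

definition p_forest ::
    "nat pair_pre_digraph \<Rightarrow> nat \<Rightarrow> ((nat \<Rightarrow> nat) \<Rightarrow> real) \<Rightarrow> nat pair_pre_digraph" where
  "p_forest T n p = \<lparr> pverts = pverts T, parcs = parcs T - isolated_edges T n p \<rparr>"

end

theory Submission
  imports Defs
begin

text \<open>
  If \<open>v\<close> lies on the tree path between \<open>i\<close> and \<open>j\<close>, then \<open>Y\<^sub>i\<close> and \<open>Y\<^sub>j\<close> are independent given the
  binary variable \<open>Y\<^sub>v\<close>, so \<open>Cov(i,j) Var(v) = Cov(i,v) Cov(v,j)\<close>; likewise the third central moment
  of three leaves separated by \<open>v\<close> satisfies
  \<open>\<mu>\<^sub>i\<^sub>j\<^sub>k Var(v)\<^sup>2 = Cov(i,v) Cov(j,v) Cov(k,v) (1 - 2 E Y\<^sub>v)\<close>.  Since \<open>(1 - 2 E Y\<^sub>v)\<^sup>2 + 4 Var(v) = 1\<close>, the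
  expression \<open>\<mu>\<^sub>i\<^sub>j\<^sub>k\<^sup>2 + 4 \<mu>\<^sub>i\<^sub>j \<mu>\<^sub>i\<^sub>k \<mu>\<^sub>j\<^sub>k\<close> equals \<open>(Cov(i,v) Cov(j,v) Cov(k,v))\<^sup>2 / Var(v)\<^sup>4\<close>, and the
  formulas follow from \<open>Cov(u,v) = \<eta>\<^sub>u\<^sub>v Var(u)\<close> by cancellation.

  The degree condition on the forest gives every inner node an edge on a path between two correlated
  leaves, hence positive variance.  Consequently the covariance of the ends of a path vanishes iff
  that of one of its edges does.  An edge with \<open>\<eta> \<noteq> 0\<close> could therefore be prolonged, along
  non-isolated edges, to a path between two correlated leaves, so it is not isolated.
\<close>

section \<open>Paths in forests\<close>

text \<open>The edge relation is a parameter because the same notion serves the tree, the forest,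
  the correlated edges and the graph with a node cut off.\<close>

definition spath :: "('a \<times> 'a) set \<Rightarrow> 'a \<Rightarrow> 'a list \<Rightarrow> 'a \<Rightarrow> bool" where
  "spath R a p b \<longleftrightarrow> p \<noteq> [] \<and> distinct p \<and> set (vwalk_arcs p) \<subseteq> R \<and> hd p = a \<and> last p = b"

lemma spath_single [simp]: "spath R a [x] b \<longleftrightarrow> x = a \<and> x = b"
  by (auto simp: spath_def)

lemma spath_Cons:
  "p \<noteq> [] \<Longrightarrow> spath R a (x # p) b \<longleftrightarrow>
     a = x \<and> x \<notin> set p \<and> (x, hd p) \<in> R \<and> spath R (hd p) p b"
  by (auto simp: spath_def)

lemma spath_append:
  "p \<noteq> [] \<Longrightarrow> q \<noteq> [] \<Longrightarrow> spath R a (p @ q) b \<longleftrightarrow>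
     set p \<inter> set q = {} \<and> (last p, hd q) \<in> R \<and> spath R a p (last p) \<and> spath R (hd q) q b"
  by (auto simp: spath_def vwalk_arcs_append)

lemma spath_mono: "spath R a p b \<Longrightarrow> R \<subseteq> S \<Longrightarrow> spath S a p b"
  by (auto simp: spath_def)

lemma spath_ends: "spath R a p b \<Longrightarrow> a \<in> set p \<and> b \<in> set p"
  by (auto simp: spath_def)

lemma set_vwalk_arcs_rev: "set (vwalk_arcs (rev p)) = (set (vwalk_arcs p))\<inverse>"
proof (induction p)
  case (Cons x p)
  then show ?case
    by (cases "p = []") (auto simp: vwalk_arcs_append last_rev)
qed simp

lemma spath_rev: "sym R \<Longrightarrow> spath R a p b \<Longrightarrow> spath R b (rev p) a"
  by (auto simp: spath_def set_vwalk_arcs_rev hd_rev last_rev dest: symD)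

lemma spath_prefix:
  assumes "spath R a (p @ v # q) b"
  shows "spath R a (p @ [v]) v"
  using assms by (cases "p = []"; cases "q = []") (auto simp: spath_append spath_Cons)

lemma spath_suffix:
  assumes "spath R a (p @ v # q) b"
  shows "spath R v (v # q) b"
  using assms by (cases "p = []") (auto simp: spath_append, auto simp: spath_def)

lemma spath_set_subset:
  assumes "spath R a p b" "R \<subseteq> V \<times> V" "a \<in> V"
  shows "set p \<subseteq> V"
  using assms
proof (induction p arbitrary: a)
  case (Cons x p)
  then show ?case
    by (cases "p = []") (auto simp: spath_Cons)
qed simp

lemma spath_imp_rtrancl: "spath R a p b \<Longrightarrow> (a, b) \<in> R\<^sup>*"
proof (induction p arbitrary: a)
  case (Cons x p)
  show ?case
  proof (cases "p = []")
    case False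
    then have "(a, hd p) \<in> R" "spath R (hd p) p b" using Cons.prems by (auto simp: spath_Cons)
    then show ?thesis using Cons.IH by (blast intro: converse_rtrancl_into_rtrancl)
  qed (use Cons.prems in auto)
qed (simp add: spath_def)

text \<open>Loop erasure: if the new first node already lies on the path, the part of the path from
  that node on is taken instead.\<close>

lemma rtrancl_imp_spath: "(a, b) \<in> R\<^sup>* \<Longrightarrow> \<exists>p. spath R a p b"
proof (induction rule: converse_rtrancl_induct)
  case base
  then show ?case by (intro exI[of _ "[b]"]) simp
next
  case (step y z)
  then obtain p where p: "spath R z p b" by blast
  show ?case
  proof (cases "y \<in> set p")
    case True
    then obtain q s where "p = q @ y # s" by (auto dest: split_list)
    then show ?thesis using p spath_suffix by metis
  next
    case False
    moreover have "p \<noteq> []" "hd p = z" using p by (auto simp: spath_def)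
    ultimately have "spath R y (y # p) b" using p step by (simp add: spath_Cons)
    then show ?thesis by blast
  qed
qed

text \<open>Separation by \<open>v\<close> becomes unreachability once all edges at \<open>v\<close>
  are deleted. The reflexive closure still relates \<open>v\<close> to itself, so reachability
  statements assume that the start differs from \<open>v\<close>.\<close>

definition avoid :: "('a \<times> 'a) set \<Rightarrow> 'a \<Rightarrow> ('a \<times> 'a) set" where
  "avoid R v = {(a, b) \<in> R. a \<noteq> v \<and> b \<noteq> v}"

lemma avoid_subset: "avoid R v \<subseteq> R"
  by (auto simp: avoid_def)

lemma sym_avoid: "sym R \<Longrightarrow> sym (avoid R v)"
  by (auto simp: avoid_def sym_def)

lemma spath_avoid:
  assumes "spath R a p b" "v \<notin> set p"
  shows "spath (avoid R v) a p b"
  using assms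
proof (induction p arbitrary: a)
  case (Cons x p)
  then show ?case
    by (cases "p = []") (auto simp: spath_Cons avoid_def)
qed (simp add: spath_def)

lemma avoid_reachable_iff:
  assumes "a \<noteq> v"
  shows "(a, b) \<in> (avoid R v)\<^sup>* \<longleftrightarrow> (\<exists>p. spath R a p b \<and> v \<notin> set p)"
proof
  assume "(a, b) \<in> (avoid R v)\<^sup>*"
  then obtain p where p: "spath (avoid R v) a p b" using rtrancl_imp_spath by metis
  moreover have "set p \<subseteq> - {v}"
    using p assms by (intro spath_set_subset[OF p]) (auto simp: avoid_def)
  ultimately show "\<exists>p. spath R a p b \<and> v \<notin> set p"
    using spath_mono[OF p avoid_subset] by (intro exI[of _ p]) auto
qed (metis spath_avoid spath_imp_rtrancl)

lemma avoid_reachable_neq: "(a, b) \<in> (avoid R v)\<^sup>* \<Longrightarrow> a \<noteq> v \<Longrightarrow> b \<noteq> v"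
  using avoid_reachable_iff spath_ends by metis

section \<open>Symmetric relations without cycles: unique paths and separation\<close>

locale acyclic_graph =
  fixes E :: "('a \<times> 'a) set"
  assumes sym_E: "sym E"
    and no_loop: "(a, a) \<notin> E"
    and no_cycle: "\<And>a p b. spath E a p b \<Longrightarrow> 3 \<le> length p \<Longrightarrow> (b, a) \<notin> E"
begin

text \<open>If two paths to \<open>b\<close> leave \<open>x\<close> through different neighbours,
  their remainders join these neighbours without meeting \<open>x\<close>. Together with
  \<open>x\<close> this closes a cycle.\<close>

lemma spath_unique:
  assumes "spath E a p b" "spath E a q b"
  shows "p = q"
  using assms
proof (induction p arbitrary: a q)
  case Nil
  then show ?case by (simp add: spath_def)
next
  case (Cons x p)
  obtain q' where q: "q = x # q'"
    using Cons.prems by (cases q) (auto simp: spath_def)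
  show ?case
  proof (cases "p = [] \<or> q' = []")
    case True
    then show ?thesis using Cons.prems last_in_set[of p] last_in_set[of q']
      by (auto simp: spath_def q split: if_splits)
  next
    case False
    then have p1: "x = a" "x \<notin> set p" "(x, hd p) \<in> E" "spath E (hd p) p b"
      and q1: "x \<notin> set q'" "(x, hd q') \<in> E" "spath E (hd q') q' b"
      using Cons.prems by (auto simp: spath_Cons q)
    have ne: "hd p \<noteq> x" "hd q' \<noteq> x" using p1 q1 False by (metis hd_in_set)+
    have "hd p = hd q'"
    proof (rule ccontr)
      assume neq: "hd p \<noteq> hd q'"
      have "(hd p, b) \<in> (avoid E x)\<^sup>*" "(hd q', b) \<in> (avoid E x)\<^sup>*"
        using p1 q1 spath_avoid spath_imp_rtrancl by metis+
      then have "(hd p, hd q') \<in> (avoid E x)\<^sup>*"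
        using sym_rtrancl[OF sym_avoid[OF sym_E]] by (meson rtrancl_trans symD)
      then obtain s where s: "spath E (hd p) s (hd q')" "x \<notin> set s"
        using avoid_reachable_iff ne by metis
      then have "spath E x (x # s) (hd q')"
        using p1 by (subst spath_Cons) (auto simp: spath_def)
      moreover have "3 \<le> length (x # s)"
        using s neq by (cases s; cases "tl s") (auto simp: spath_def)
      ultimately show False
        using no_cycle q1 sym_E by (meson symD)
    qed
    then show ?thesis using Cons.IH p1 q1 q by metis
  qed
qed

text \<open>By uniqueness, a path that misses \<open>v\<close> would equal the given path, which
  contains \<open>v\<close>.\<close>

lemma on_path_imp_separated:
  assumes "spath E a p b" "v \<in> set p" "a \<noteq> v"
  shows "(a, b) \<notin> (avoid E v)\<^sup>*"
  using assms avoid_reachable_iff spath_unique by metis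

text \<open>The path from \<open>a\<close> to \<open>u\<close> must pass \<open>v\<close>, and its
  piece up to \<open>v\<close> stops before \<open>u\<close>.\<close>

lemma separated_swap:
  assumes "(a, u) \<in> E\<^sup>*" "(a, u) \<notin> (avoid E v)\<^sup>*" "a \<noteq> u" "a \<noteq> v" "u \<noteq> v"
  shows "(a, v) \<in> (avoid E u)\<^sup>*"
proof -
  obtain p where p: "spath E a p u" using assms rtrancl_imp_spath by metis
  then have "v \<in> set p" using avoid_reachable_iff assms by metis
  then obtain q s where qs: "p = q @ v # s" by (auto dest: split_list)
  have "spath E a (q @ [v]) v" using p qs spath_prefix by metis
  moreover have "u \<in> set s" using p qs assms by (auto simp: spath_def split: if_splits)
  then have "u \<notin> set (q @ [v])" using p qs by (auto simp: spath_def)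
  ultimately show ?thesis using avoid_reachable_iff assms by metis
qed

text \<open>A neighbour of the end \<open>b\<close> other than its predecessor would either extend
  the path or, if it lies on the path already, close a cycle.\<close>

lemma maximal_path_end:
  assumes p: "spath R a p b" "2 \<le> length p" and R: "R \<subseteq> E"
    and max: "\<And>q. spath R a (p @ q) (last (p @ q)) \<Longrightarrow> q = []"
    and y: "(b, y) \<in> R" "(b, y') \<in> R" "y \<noteq> y'"
  shows False
proof -
  \<comment> \<open>\<open>last (butlast p)\<close> is the predecessor of \<open>b\<close>; of two
    distinct neighbours at least one differs from it.\<close>
  have False if y: "(b, y) \<in> R" "y \<noteq> last (butlast p)" for y
  proof (cases "y \<in> set p")
    case False
    have "spath R a (p @ [y]) y"
      using p y False by (subst spath_append) (auto simp: spath_def)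
    then show False using max[of "[y]"] by simp
  next
    case True
    then obtain q s where qs: "p = q @ y # s" by (auto dest: split_list)
    have b: "last p = b" using p by (simp add: spath_def)
    have sp: "spath E y (y # s) b" using p qs R spath_mono spath_suffix by metis
    have "s \<noteq> []" using no_loop y R b qs by auto
    moreover have "tl s \<noteq> []"
    proof
      assume "tl s = []"
      then have "s = [hd s]" using \<open>s \<noteq> []\<close> by (metis list.collapse)
      then have "p = (q @ [y]) @ [hd s]" using qs by simp
      then show False using y by (metis butlast_snoc last_snoc)
    qed
    ultimately have "3 \<le> length (y # s)" by (cases s; cases "tl s") auto
    then show False using no_cycle[OF sp] y R by blast
  qed
  then show False using y by metis
qed

end

section \<open>Directed tree models and conditional independence\<close>

definition depends_on :: "nat set \<Rightarrow> ((nat \<Rightarrow> nat) \<Rightarrow> real) \<Rightarrow> bool" where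
  "depends_on S F \<longleftrightarrow> (\<forall>\<alpha> \<beta>. (\<forall>w\<in>S. \<alpha> w = \<beta> w) \<longrightarrow> F \<alpha> = F \<beta>)"

lemma depends_onD: "depends_on S F \<Longrightarrow> (\<And>w. w \<in> S \<Longrightarrow> \<alpha> w = \<beta> w) \<Longrightarrow> F \<alpha> = F \<beta>"
  by (auto simp: depends_on_def)

lemma depends_on_mult:
  "depends_on S F \<Longrightarrow> depends_on S G \<Longrightarrow> depends_on S (\<lambda>\<alpha>. F \<alpha> * G \<alpha>)"
  unfolding depends_on_def by metis

lemma depends_on_const [simp]: "depends_on S (\<lambda>_. x)"
  by (auto simp: depends_on_def)

lemma depends_on_mono: "depends_on S F \<Longrightarrow> S \<subseteq> S' \<Longrightarrow> depends_on S' F"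
  unfolding depends_on_def by (meson subsetD)

lemma depends_on_upd:
  "depends_on (insert v S) F \<Longrightarrow> depends_on S (\<lambda>\<alpha>. F (\<alpha>(v := s)))"
  unfolding depends_on_def by (auto simp: fun_upd_def)

lemma cube_val: "\<alpha> \<in> cube S \<Longrightarrow> w \<in> S \<Longrightarrow> \<alpha> w = 0 \<or> \<alpha> w = 1"
  by (auto simp: PiE_iff)

lemma sum_cube_Un:
  assumes "A \<inter> B = {}"
  shows "(\<Sum>\<alpha>\<in>cube (A \<union> B). h \<alpha>) =
    (\<Sum>(x, y)\<in>cube A \<times> cube B. h (\<lambda>w. if w \<in> A then x w else y w))"
proof (rule sum.reindex_bij_witness[where
      i = "\<lambda>(x, y) w. if w \<in> A then x w else y w" and
      j = "\<lambda>\<alpha>. (restrict \<alpha> A, restrict \<alpha> B)"])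
  show "(case (restrict \<alpha> A, restrict \<alpha> B) of (x, y) \<Rightarrow> \<lambda>w. if w \<in> A then x w else y w) = \<alpha>"
    if "\<alpha> \<in> cube (A \<union> B)" for \<alpha>
    using that by (auto simp: fun_eq_iff PiE_iff extensional_def)
  then show "(case (restrict \<alpha> A, restrict \<alpha> B) of
      (x, y) \<Rightarrow> h (\<lambda>w. if w \<in> A then x w else y w)) = h \<alpha>"
    if "\<alpha> \<in> cube (A \<union> B)" for \<alpha>
    using that by simp
  show "(restrict \<alpha> A, restrict \<alpha> B) \<in> cube A \<times> cube B" if "\<alpha> \<in> cube (A \<union> B)" for \<alpha>
    using that by (auto simp: PiE_iff)
  show "(restrict (case z of (x, y) \<Rightarrow> \<lambda>w. if w \<in> A then x w else y w) A,
      restrict (case z of (x, y) \<Rightarrow> \<lambda>w. if w \<in> A then x w else y w) B) = z"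
    if "z \<in> cube A \<times> cube B" for z
    using that assms by (cases z) (auto simp: fun_eq_iff PiE_iff extensional_def)
  show "(case z of (x, y) \<Rightarrow> \<lambda>w. if w \<in> A then x w else y w) \<in> cube (A \<union> B)"
    if "z \<in> cube A \<times> cube B" for z
    using that by (cases z) (auto simp: PiE_iff extensional_def)
qed

text \<open>Fubini for finite cubes. It turns a factorisation of the joint weight into
  independence.\<close>

lemma sum_cube_mult:
  assumes "A \<inter> B = {}" "depends_on A F" "depends_on B G"
  shows "(\<Sum>\<alpha>\<in>cube (A \<union> B). F \<alpha> * G \<alpha>) = (\<Sum>\<alpha>\<in>cube A. F \<alpha>) * (\<Sum>\<alpha>\<in>cube B. G \<alpha>)"
proof -
  have "(\<Sum>\<alpha>\<in>cube (A \<union> B). F \<alpha> * G \<alpha>) = (\<Sum>(x, y)\<in>cube A \<times> cube B. F x * G y)"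
    unfolding sum_cube_Un[OF assms(1)]
  proof (intro sum.cong refl, clarify)
    fix x y
    show "F (\<lambda>w. if w \<in> A then x w else y w) * G (\<lambda>w. if w \<in> A then x w else y w) = F x * G y"
      using assms(1)
      by (intro arg_cong2[of _ _ _ _ "(*)"] depends_onD[OF assms(2)] depends_onD[OF assms(3)]) auto
  qed
  then show ?thesis by (simp add: sum_product sum.cartesian_product)
qed

lemma sum_cube_insert:
  assumes "v \<notin> A"
  shows "(\<Sum>\<alpha>\<in>cube (insert v A). h \<alpha>) = (\<Sum>\<alpha>\<in>cube A. h (\<alpha>(v := 0)) + h (\<alpha>(v := 1)))"
proof -
  have "(\<Sum>\<alpha>\<in>cube (insert v A). h \<alpha>) = (\<Sum>(\<alpha>, s)\<in>cube A \<times> {0, 1}. h (\<alpha>(v := s)))"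
  proof (rule sum.reindex_bij_witness[where
        i = "\<lambda>(\<alpha>, s). \<alpha>(v := s)" and j = "\<lambda>\<alpha>. (restrict \<alpha> A, \<alpha> v)"])
    have *: "(restrict \<alpha> A)(v := \<alpha> v) = \<alpha>" if "\<alpha> \<in> cube (insert v A)" for \<alpha>
      using that by (auto simp: fun_eq_iff PiE_iff extensional_def)
    show "(case (restrict \<alpha> A, \<alpha> v) of (\<alpha>, s) \<Rightarrow> \<alpha>(v := s)) = \<alpha>"
      "(case (restrict \<alpha> A, \<alpha> v) of (\<alpha>, s) \<Rightarrow> h (\<alpha>(v := s))) = h \<alpha>"
      if "\<alpha> \<in> cube (insert v A)" for \<alpha>
      using *[OF that] by simp_all
    show "(restrict \<alpha> A, \<alpha> v) \<in> cube A \<times> {0, 1}" if "\<alpha> \<in> cube (insert v A)" for \<alpha>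
      using that by (auto simp: PiE_iff)
    show "(restrict (case z of (\<alpha>, s) \<Rightarrow> \<alpha>(v := s)) A, (case z of (\<alpha>, s) \<Rightarrow> \<alpha>(v := s)) v) = z"
      if "z \<in> cube A \<times> {0, 1}" for z
      using that assms by (cases z) (auto simp: fun_eq_iff PiE_iff extensional_def)
    show "(case z of (\<alpha>, s) \<Rightarrow> \<alpha>(v := s)) \<in> cube (insert v A)"
      if "z \<in> cube A \<times> {0, 1}" for z
      using that by (cases z) (auto simp: PiE_iff extensional_def)
  qed
  also have "\<dots> = (\<Sum>\<alpha>\<in>cube A. \<Sum>s\<in>{0, 1}. h (\<alpha>(v := s)))"
    by (simp only: sum.cartesian_product)
  finally show ?thesis by simp
qed

text \<open>\<open>c v a b\<close> is the probability of the value \<open>a\<close> at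
  \<open>v\<close> given the value \<open>b\<close> at the parent. Nothing is assumed about
  \<open>pa r\<close>, so \<open>c_root\<close> makes the factor of the root independent of the
  value there. \<open>dep\<close> excludes cycles of \<open>pa\<close> and gives the order in which
  nodes are summed out.\<close>

locale tree_model =
  fixes V :: "nat set" and r :: nat and pa dep :: "nat \<Rightarrow> nat"
    and c :: "nat \<Rightarrow> nat \<Rightarrow> nat \<Rightarrow> real"
  assumes finite_V: "finite V" and root_in_V: "r \<in> V"
    and pa_in_V: "\<And>v. v \<in> V \<Longrightarrow> v \<noteq> r \<Longrightarrow> pa v \<in> V"
    and dep_pa: "\<And>v. v \<in> V \<Longrightarrow> v \<noteq> r \<Longrightarrow> dep (pa v) < dep v"
    and c_root: "\<And>a b b'. c r a b = c r a b'"
    and c_sum: "\<And>v b. v \<in> V \<Longrightarrow> (v \<noteq> r \<Longrightarrow> b = 0 \<or> b = 1) \<Longrightarrow> c v 0 b + c v 1 b = 1"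
    and c_nonneg: "\<And>v a b. v \<in> V \<Longrightarrow> (v \<noteq> r \<Longrightarrow> b = 0 \<or> b = 1) \<Longrightarrow> a = 0 \<or> a = 1 \<Longrightarrow> 0 \<le> c v a b"
begin

definition E :: "nat rel" where
  "E = {(a, b). a \<in> V \<and> a \<noteq> r \<and> pa a = b \<or> b \<in> V \<and> b \<noteq> r \<and> pa b = a}"

lemma sym_E: "sym E"
  by (auto simp: E_def sym_def)

lemma E_subset: "E \<subseteq> V \<times> V"
  using pa_in_V by (auto simp: E_def)

lemma pa_neq: "v \<in> V \<Longrightarrow> v \<noteq> r \<Longrightarrow> pa v \<noteq> v"
  using dep_pa by force

definition weight :: "nat set \<Rightarrow> (nat \<Rightarrow> nat) \<Rightarrow> real" where
  "weight A \<alpha> = (\<Prod>v\<in>A. c v (\<alpha> v) (\<alpha> (pa v)))"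

definition expec :: "((nat \<Rightarrow> nat) \<Rightarrow> real) \<Rightarrow> real" where
  "expec F = (\<Sum>\<alpha>\<in>cube V. weight V \<alpha> * F \<alpha>)"

lemma depends_on_weight:
  assumes "\<And>w. w \<in> S \<Longrightarrow> w \<in> D" "\<And>w. w \<in> S \<Longrightarrow> w \<noteq> r \<Longrightarrow> pa w \<in> D"
  shows "depends_on D (weight S)"
  unfolding depends_on_def weight_def
proof (intro allI impI prod.cong refl)
  fix \<alpha> \<beta> w assume "\<forall>w\<in>D. \<alpha> w = (\<beta> w :: nat)" "w \<in> S"
  then show "c w (\<alpha> w) (\<alpha> (pa w)) = c w (\<beta> w) (\<beta> (pa w))"
    using assms c_root by (cases "w = r") auto
qed

text \<open>For such sets the marginal distribution is again the product of the conditional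
  probabilities.\<close>

definition ancestral :: "nat set \<Rightarrow> bool" where
  "ancestral A \<longleftrightarrow> A \<subseteq> V \<and> (\<forall>v\<in>A. v \<noteq> r \<longrightarrow> pa v \<in> A)"

text \<open>Among the nodes outside \<open>A\<close> one of greatest \<open>dep\<close> is not the
  parent of any node of \<open>B\<close>. So its value enters only its own factor, which sums to
  one, and the node can be removed; induction removes the others.\<close>

lemma sum_ancestral:
  assumes "ancestral A" "depends_on A F" "ancestral B" "A \<subseteq> B"
  shows "(\<Sum>\<alpha>\<in>cube B. weight B \<alpha> * F \<alpha>) = (\<Sum>\<alpha>\<in>cube A. weight A \<alpha> * F \<alpha>)"
  using assms(3,4)
proof (induction "card (B - A)" arbitrary: B)
  case 0
  have "finite B" using 0 finite_V finite_subset by (auto simp: ancestral_def)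
  then show ?case using 0 by (metis Diff_eq_empty_iff card_0_eq finite_Diff subset_antisym)
next
  case (Suc n)
  have fin: "finite B" using Suc finite_V finite_subset by (auto simp: ancestral_def)
  have "B - A \<noteq> {}" using Suc by (metis card.empty nat.distinct(1))
  then have "Max (dep ` (B - A)) \<in> dep ` (B - A)" using fin by (intro Max_in) auto
  then obtain v where v: "v \<in> B - A" "dep v = Max (dep ` (B - A))" by auto
  have v_max: "dep w \<le> dep v" if "w \<in> B - A" for w
    using that fin unfolding v(2) by (intro Max_ge) auto
  define B' where "B' = B - {v}"
  have B: "B = insert v B'" "v \<notin> B'" "finite B'" using v fin by (auto simp: B'_def)
  have vV: "v \<in> V" using v Suc by (auto simp: ancestral_def)
  have pa_B': "pa w \<in> B'" if "w \<in> B'" "w \<noteq> r" for w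
  proof -
    have "pa w \<in> B" "w \<in> V" using that Suc by (auto simp: ancestral_def B'_def)
    moreover have "pa w \<noteq> v"
    proof (cases "w \<in> A")
      case True
      then show ?thesis using assms(1) that v by (auto simp: ancestral_def)
    next
      case False
      then have "dep w \<le> dep v" using v_max that by (auto simp: B'_def)
      then show ?thesis using dep_pa[of w] \<open>w \<in> V\<close> that by auto
    qed
    ultimately show ?thesis by (simp add: B'_def)
  qed
  have anc: "ancestral B'" using Suc.prems pa_B' by (auto simp: ancestral_def B'_def)
  have "card (B - A) = Suc (card (B' - A))"
    using v B by (subst card_insert_disjoint[symmetric]) (auto intro: arg_cong[of _ _ card])
  then have card: "n = card (B' - A)" using Suc by simp
  have step: "weight B (\<alpha>(v := 0)) * F (\<alpha>(v := 0)) + weight B (\<alpha>(v := 1)) * F (\<alpha>(v := 1)) =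
      weight B' \<alpha> * F \<alpha>" if "\<alpha> \<in> cube B'" for \<alpha>
  proof -
    have F: "F (\<alpha>(v := s)) = F \<alpha>" for s
      using v by (intro depends_onD[OF assms(2)]) auto
    have W: "weight B' (\<alpha>(v := s)) = weight B' \<alpha>" for s
      using B pa_B' by (intro depends_onD[OF depends_on_weight[of B' B']]) auto
    \<comment> \<open>Away from the root the parent differs from \<open>v\<close>. At the root
      \<open>pa v\<close> might be \<open>v\<close> itself, and \<open>c_root\<close> absorbs the
      update.\<close>
    have C: "c v s ((\<alpha>(v := s)) (pa v)) = c v s (\<alpha> (pa v))" for s
      using pa_neq[OF vV] c_root by (cases "v = r") auto
    have "weight B (\<alpha>(v := s)) = c v s (\<alpha> (pa v)) * weight B' \<alpha>" for s
      using W[of s] C[of s] B by (simp add: weight_def)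
    moreover have "c v 0 (\<alpha> (pa v)) + c v 1 (\<alpha> (pa v)) = 1"
    proof (rule c_sum[OF vV])
      assume "v \<noteq> r"
      then have "pa v \<in> B'" using Suc.prems v pa_neq[OF vV] by (auto simp: ancestral_def B'_def)
      then show "\<alpha> (pa v) = 0 \<or> \<alpha> (pa v) = 1" using that cube_val by blast
    qed
    ultimately show ?thesis using F by (simp flip: distrib_right)
  qed
  have "(\<Sum>\<alpha>\<in>cube B. weight B \<alpha> * F \<alpha>) = (\<Sum>\<alpha>\<in>cube B'. weight B' \<alpha> * F \<alpha>)"
    unfolding B(1) sum_cube_insert[OF B(2)] using step B(1) by (intro sum.cong) auto
  also have "\<dots> = (\<Sum>\<alpha>\<in>cube A. weight A \<alpha> * F \<alpha>)"
    using Suc.hyps(1)[OF card anc] Suc.prems v by (auto simp: B'_def)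
  finally show ?case .
qed

lemma ancestral_V: "ancestral V"
  using pa_in_V by (auto simp: ancestral_def)

lemma expec_ancestral:
  "ancestral A \<Longrightarrow> depends_on A F \<Longrightarrow> expec F = (\<Sum>\<alpha>\<in>cube A. weight A \<alpha> * F \<alpha>)"
  unfolding expec_def by (rule sum_ancestral) (auto simp: ancestral_V, auto simp: ancestral_def)

lemma expec_cong: "(\<And>\<alpha>. \<alpha> \<in> cube V \<Longrightarrow> F \<alpha> = G \<alpha>) \<Longrightarrow> expec F = expec G"
  unfolding expec_def by (intro sum.cong) auto

lemma expec_cong_cases:
  assumes "v \<in> V" "\<And>\<alpha>. \<alpha> v = 0 \<Longrightarrow> F \<alpha> = G \<alpha>" "\<And>\<alpha>. \<alpha> v = 1 \<Longrightarrow> F \<alpha> = G \<alpha>"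
  shows "expec F = expec G"
  using assms cube_val[OF _ assms(1)] by (intro expec_cong) blast

lemma expec_add: "expec (\<lambda>\<alpha>. F \<alpha> + G \<alpha>) = expec F + expec G"
  by (simp add: expec_def distrib_left sum.distrib)

lemma expec_diff: "expec (\<lambda>\<alpha>. F \<alpha> - G \<alpha>) = expec F - expec G"
  by (simp add: expec_def right_diff_distrib sum_subtractf)

lemma expec_cmult: "expec (\<lambda>\<alpha>. x * F \<alpha>) = x * expec F"
  by (simp add: expec_def sum_distrib_left mult_ac)

text \<open>All nodes are summed out: the empty set is ancestral and its weight is the empty
  product.\<close>

lemma expec_one: "expec (\<lambda>_. 1) = 1"
  using expec_ancestral[of "{}" "\<lambda>_. 1"] by (simp add: ancestral_def weight_def)

lemma expec_const: "expec (\<lambda>_. x) = x"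
  using expec_cmult[of x "\<lambda>_. 1"] expec_one by simp

lemmas expec_linear = expec_add expec_diff expec_cmult expec_const

text \<open>This identifies \<open>c v 1\<close> as a conditional probability. The nodes of smaller
  \<open>dep\<close> form an ancestral set that contains \<open>pa v\<close> but not
  \<open>v\<close>, so \<open>v\<close> can be summed out first.\<close>

lemma expec_child:
  assumes v: "v \<in> V" "v \<noteq> r" and G: "depends_on {pa v} G"
  shows "expec (\<lambda>\<alpha>. G \<alpha> * real (\<alpha> v)) = expec (\<lambda>\<alpha>. G \<alpha> * c v 1 (\<alpha> (pa v)))"
proof -
  define A where "A = {w \<in> V. dep w < dep v}"
  have A: "ancestral A" "v \<notin> A" "pa v \<in> A" "finite A"
    using dep_pa pa_in_V v finite_V by (force simp: ancestral_def A_def)+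
  then have iA: "ancestral (insert v A)" using v by (auto simp: ancestral_def)
  have GA: "depends_on A G" using depends_on_mono[OF G] A by auto
  have "expec (\<lambda>\<alpha>. G \<alpha> * real (\<alpha> v)) =
      (\<Sum>\<alpha>\<in>cube (insert v A). weight (insert v A) \<alpha> * (G \<alpha> * real (\<alpha> v)))"
    by (rule expec_ancestral[OF iA])
      (intro depends_on_mult depends_on_mono[OF GA], auto simp: depends_on_def)
  also have "\<dots> = (\<Sum>\<alpha>\<in>cube A. weight A \<alpha> * (G \<alpha> * c v 1 (\<alpha> (pa v))))"
    unfolding sum_cube_insert[OF A(2)]
  proof (intro sum.cong refl)
    fix \<alpha>
    have "weight A (\<alpha>(v := s)) = weight A \<alpha>" for s
      using A by (intro depends_onD[OF depends_on_weight[of A A]]) (auto simp: ancestral_def)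
    then have "weight (insert v A) (\<alpha>(v := 1)) = c v 1 (\<alpha> (pa v)) * weight A \<alpha>"
      using A pa_neq[OF v] by (simp add: weight_def)
    moreover have "G (\<alpha>(v := 1)) = G \<alpha>"
      using A by (intro depends_onD[OF GA]) auto
    ultimately show "weight (insert v A) (\<alpha>(v := 0)) * (G (\<alpha>(v := 0)) * real ((\<alpha>(v := 0)) v)) +
      weight (insert v A) (\<alpha>(v := 1)) * (G (\<alpha>(v := 1)) * real ((\<alpha>(v := 1)) v)) =
      weight A \<alpha> * (G \<alpha> * c v 1 (\<alpha> (pa v)))" by simp
  qed
  also have "\<dots> = expec (\<lambda>\<alpha>. G \<alpha> * c v 1 (\<alpha> (pa v)))"
    using A by (intro expec_ancestral[symmetric] depends_on_mult[OF GA]) (auto simp: depends_on_def)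
  finally show ?thesis .
qed

section \<open>Means, variances and covariances of the node variables\<close>

definition mean :: "nat \<Rightarrow> real" where
  "mean v = expec (\<lambda>\<alpha>. real (\<alpha> v))"

definition Z :: "nat \<Rightarrow> (nat \<Rightarrow> nat) \<Rightarrow> real" where
  "Z v \<alpha> = real (\<alpha> v) - mean v"

definition var :: "nat \<Rightarrow> real" where
  "var v = mean v * (1 - mean v)"

definition cov :: "nat \<Rightarrow> nat \<Rightarrow> real" where
  "cov a b = expec (\<lambda>\<alpha>. Z a \<alpha> * Z b \<alpha>)"

definition cov3 :: "nat \<Rightarrow> nat \<Rightarrow> nat \<Rightarrow> real" where
  "cov3 a b d = expec (\<lambda>\<alpha>. Z a \<alpha> * Z b \<alpha> * Z d \<alpha>)"

lemma cov_sym: "cov a b = cov b a"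
  by (simp add: cov_def mult.commute)

lemma expec_Z: "expec (Z v) = 0"
  unfolding Z_def by (simp add: expec_linear mean_def)

lemma cov_eq: "cov a b = expec (\<lambda>\<alpha>. real (\<alpha> a) * real (\<alpha> b)) - mean a * mean b"
proof -
  have "cov a b = expec (\<lambda>\<alpha>. real (\<alpha> a) * real (\<alpha> b) - mean b * real (\<alpha> a)
      - (mean a * real (\<alpha> b) - mean a * mean b))"
    unfolding cov_def Z_def by (simp add: algebra_simps)
  then show ?thesis by (simp add: expec_linear flip: mean_def)
qed

lemma cov_self: "v \<in> V \<Longrightarrow> cov v v = var v"
proof -
  assume "v \<in> V"
  then have "expec (\<lambda>\<alpha>. real (\<alpha> v) * real (\<alpha> v)) = mean v"
    unfolding mean_def by (intro expec_cong_cases[of v]) auto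
  then show ?thesis by (simp add: cov_eq var_def algebra_simps)
qed

text \<open>The slope is the edge parameter: on the values 0 and 1 the conditional probability is an
  affine function of the value at the parent.\<close>

lemma cov_parent:
  assumes "v \<in> V" "v \<noteq> r"
  shows "cov (pa v) v = (c v 1 1 - c v 1 0) * var (pa v)"
proof -
  let ?u = "pa v" and ?t = "c v 1"
  have u: "?u \<in> V" using assms pa_in_V by blast
  have lin: "?t (\<alpha> ?u) = ?t 0 + (?t 1 - ?t 0) * real (\<alpha> ?u)" if "\<alpha> \<in> cube V" for \<alpha>
    using cube_val[OF that u] by auto
  have "mean v = expec (\<lambda>\<alpha>. ?t (\<alpha> ?u))"
    using expec_child[OF assms, of "\<lambda>_. 1"] by (simp add: mean_def)
  also have "\<dots> = expec (\<lambda>\<alpha>. ?t 0 + (?t 1 - ?t 0) * real (\<alpha> ?u))"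
    using lin by (rule expec_cong)
  also have "\<dots> = ?t 0 + (?t 1 - ?t 0) * mean ?u"
    by (simp add: expec_linear mean_def)
  finally have m: "mean v = ?t 0 + (?t 1 - ?t 0) * mean ?u" .
  have "expec (\<lambda>\<alpha>. real (\<alpha> ?u) * real (\<alpha> v)) = expec (\<lambda>\<alpha>. real (\<alpha> ?u) * ?t (\<alpha> ?u))"
    by (rule expec_child[OF assms]) (auto simp: depends_on_def)
  \<comment> \<open>The product vanishes at the parent value 0, so only \<open>?t 1\<close>
    survives.\<close>
  also have "\<dots> = expec (\<lambda>\<alpha>. ?t 1 * real (\<alpha> ?u))"
    by (rule expec_cong_cases[OF u]) auto
  also have "\<dots> = ?t 1 * mean ?u"
    by (simp add: expec_linear mean_def)
  finally show ?thesis
    unfolding cov_eq m by (simp add: var_def algebra_simps)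
qed

text \<open>\<open>expec_at v s F\<close> is the unnormalised conditional expectation \<open>E[F; Y\<^sub>v = s]\<close>; working with it
  keeps conditional independence meaningful when \<open>Y\<^sub>v\<close> is degenerate.\<close>

definition expec_at :: "nat \<Rightarrow> nat \<Rightarrow> ((nat \<Rightarrow> nat) \<Rightarrow> real) \<Rightarrow> real" where
  "expec_at v s F = expec (\<lambda>\<alpha>. of_bool (\<alpha> v = s) * F \<alpha>)"

lemma expec_split: "v \<in> V \<Longrightarrow> expec F = expec_at v 0 F + expec_at v 1 F"
  unfolding expec_at_def expec_add[symmetric] by (intro expec_cong_cases[of v]) auto

lemma expec_at_1: "v \<in> V \<Longrightarrow> expec_at v 1 F = expec (\<lambda>\<alpha>. real (\<alpha> v) * F \<alpha>)"
  unfolding expec_at_def by (intro expec_cong_cases[of v]) auto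

lemma expec_at_prob: "v \<in> V \<Longrightarrow> expec_at v 1 (\<lambda>_. 1) = mean v" "v \<in> V \<Longrightarrow> expec_at v 0 (\<lambda>_. 1) = 1 - mean v"
  using expec_at_1[of v "\<lambda>_. 1"] expec_split[of v "\<lambda>_. 1"] by (simp_all add: mean_def expec_one)

text \<open>Since \<open>Z i\<close> is centred, its parts over the two values at \<open>v\<close>
  cancel, and centring \<open>v\<close> does not change the part at 1.\<close>

lemma expec_at_Z:
  assumes "v \<in> V"
  shows "expec_at v 1 (Z i) = cov i v" "expec_at v 0 (Z i) = - cov i v"
proof -
  have "cov i v = expec (\<lambda>\<alpha>. real (\<alpha> v) * Z i \<alpha> - mean v * Z i \<alpha>)"
    unfolding cov_def Z_def[of v] by (simp add: algebra_simps)
  then show "expec_at v 1 (Z i) = cov i v"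
    by (simp add: expec_linear expec_Z expec_at_1[OF assms] del: One_nat_def)
  then show "expec_at v 0 (Z i) = - cov i v"
    using expec_split[OF assms, of "Z i"] expec_Z[of i] by simp
qed

lemma weight_nonneg: "\<alpha> \<in> cube V \<Longrightarrow> 0 \<le> weight V \<alpha>"
  unfolding weight_def using pa_in_V cube_val by (intro prod_nonneg ballI c_nonneg) metis+

text \<open>Nonnegative weights with sum zero vanish one by one.\<close>

lemma expec_at_null:
  assumes "expec_at v s (\<lambda>_. 1) = 0"
  shows "expec_at v s F = 0"
proof -
  have "\<forall>\<alpha>\<in>cube V. weight V \<alpha> * of_bool (\<alpha> v = s) = 0"
    using assms weight_nonneg finite_V
    by (subst (asm) expec_at_def, subst (asm) expec_def) (subst (asm) sum_nonneg_eq_0_iff, auto simp: finite_PiE)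
  then show ?thesis
    unfolding expec_at_def expec_def by (intro sum.neutral) auto
qed

text \<open>The factor of \<open>v\<close> itself is assigned to the side that contains its parent.\<close>

lemma cond_indep:
  assumes v: "v \<in> V" and A: "A \<subseteq> V - {v}" and B: "B = V - {v} - A"
    and cut: "\<And>a b. a \<in> A \<Longrightarrow> b \<in> B \<Longrightarrow> (a, b) \<notin> E"
    and f: "depends_on A f" and g: "depends_on B g" and s: "s = 0 \<or> s = 1"
  shows "expec_at v s (\<lambda>\<alpha>. f \<alpha> * g \<alpha>) * expec_at v s (\<lambda>_. 1) = expec_at v s f * expec_at v s g"
proof -
  define A' where "A' = A \<union> (if v \<noteq> r \<and> pa v \<in> A then {v} else {})"
  define B' where "B' = V - A'"
  let ?up = "\<lambda>F \<alpha>. F (\<alpha>(v := s)) :: real"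
  have V: "V = insert v (A \<union> B)" "v \<notin> A \<union> B" "A \<inter> B = {}" using v A B by auto
  have cutp: "pa a \<notin> B" "a \<in> V" if "a \<in> A" "a \<noteq> r" for a
    using that cut[of a "pa a"] A by (auto simp: E_def)
  have cutp': "pa a \<notin> A" "a \<in> V" if "a \<in> B" "a \<noteq> r" for a
    using that cut[of "pa a" a] B by (auto simp: E_def)
  have dA: "depends_on (insert v A) (weight A')"
    by (rule depends_on_weight)
      (use cutp pa_in_V B in \<open>auto simp: A'_def split: if_splits\<close>)
  have dB: "depends_on (insert v B) (weight B')"
  proof (rule depends_on_weight)
    fix w assume w: "w \<in> B'"
    then show "w \<in> insert v B" by (auto simp: A'_def B'_def B)
    assume "w \<noteq> r"
    then show "pa w \<in> insert v B"
      using w cutp'[of w] pa_in_V[of w] by (auto simp: A'_def B'_def B split: if_splits)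
  qed
  \<comment> \<open>Once the value at \<open>v\<close> is fixed, the factors in \<open>A'\<close>
    and those in \<open>B'\<close> depend on the disjoint coordinate sets \<open>A\<close> and
    \<open>B\<close>.\<close>
  have split: "expec_at v s (\<lambda>\<alpha>. F \<alpha> * G \<alpha>) =
      (\<Sum>\<alpha>\<in>cube A. ?up (weight A') \<alpha> * ?up F \<alpha>) * (\<Sum>\<alpha>\<in>cube B. ?up (weight B') \<alpha> * ?up G \<alpha>)"
    if F: "depends_on A F" and G: "depends_on B G" for F G
  proof -
    have wV: "weight V \<alpha> = weight A' \<alpha> * weight B' \<alpha>" for \<alpha>
      unfolding weight_def B'_def using A v finite_V
      by (subst prod.subset_diff[of A' V]) (auto simp: A'_def)
    have "expec_at v s (\<lambda>\<alpha>. F \<alpha> * G \<alpha>) =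
        (\<Sum>\<alpha>\<in>cube (insert v (A \<union> B)). weight V \<alpha> * (of_bool (\<alpha> v = s) * (F \<alpha> * G \<alpha>)))"
      unfolding expec_at_def expec_def by (simp only: V(1)[symmetric])
    also have "\<dots> = (\<Sum>\<alpha>\<in>cube (A \<union> B). (?up (weight A') \<alpha> * ?up F \<alpha>) * (?up (weight B') \<alpha> * ?up G \<alpha>))"
      unfolding sum_cube_insert[OF V(2)] using s by (auto simp: wV mult_ac)
    also have "\<dots> = (\<Sum>\<alpha>\<in>cube A. ?up (weight A') \<alpha> * ?up F \<alpha>) *
        (\<Sum>\<alpha>\<in>cube B. ?up (weight B') \<alpha> * ?up G \<alpha>)"
      by (intro sum_cube_mult V depends_on_mult depends_on_upd dA dB
          depends_on_mono[OF F] depends_on_mono[OF G]) auto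
    finally show ?thesis .
  qed
  \<comment> \<open>Splitting the pairs \<open>f, g\<close>, \<open>1, 1\<close>,
    \<open>f, 1\<close> and \<open>1, g\<close> writes both sides as the product of the same four
    sums.\<close>
  show ?thesis
    using split[OF f g] split[OF depends_on_const depends_on_const, of 1 1]
      split[OF f depends_on_const, of 1] split[OF depends_on_const g, of 1]
    by simp
qed

section \<open>Second and third moments at a separating node\<close>

definition separated :: "nat \<Rightarrow> nat \<Rightarrow> nat \<Rightarrow> bool" where
  "separated v i j \<longleftrightarrow> i \<noteq> v \<and> j \<noteq> v \<and> (i, j) \<notin> (avoid E v)\<^sup>*"

lemma separated_sym: "separated v i j \<Longrightarrow> separated v j i"
  unfolding separated_def using sym_rtrancl[OF sym_avoid[OF sym_E]] by (meson symD)

text \<open>\<open>A\<close> is the component of \<open>i\<close> after \<open>v\<close> is cut off.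
  Edges can leave it only towards \<open>v\<close>, and all of \<open>S\<close> lies on the other
  side.\<close>

lemma cond_indep_separated:
  assumes "v \<in> V" "i \<in> V" "S \<subseteq> V" "\<And>j. j \<in> S \<Longrightarrow> separated v i j" "S \<noteq> {}"
    and g: "depends_on S g" and s: "s = 0 \<or> s = 1"
  shows "expec_at v s (\<lambda>\<alpha>. Z i \<alpha> * g \<alpha>) * expec_at v s (\<lambda>_. 1) = expec_at v s (Z i) * expec_at v s g"
proof -
  define A where "A = {a. (i, a) \<in> (avoid E v)\<^sup>*}"
  have iv: "i \<noteq> v" using assms by (auto simp: separated_def)
  have AV: "a \<in> V" if "(i, a) \<in> (avoid E v)\<^sup>*" for a
    using that by induction (use assms E_subset in \<open>auto simp: avoid_def\<close>)
  have "A \<subseteq> V - {v}" unfolding A_def using AV avoid_reachable_neq iv by fastforce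
  moreover have "(a, b) \<notin> E" if "a \<in> A" "b \<in> V - {v} - A" for a b
  proof
    assume "(a, b) \<in> E"
    moreover have "a \<noteq> v" using that \<open>A \<subseteq> V - {v}\<close> by auto
    ultimately have "(a, b) \<in> avoid E v" using that by (auto simp: avoid_def)
    then show False using that by (auto simp: A_def intro: rtrancl_into_rtrancl)
  qed
  moreover have "depends_on A (Z i)" by (auto simp: depends_on_def A_def Z_def)
  moreover have "depends_on (V - {v} - A) g"
    using assms by (intro depends_on_mono[OF g]) (auto simp: separated_def A_def)
  ultimately show ?thesis using cond_indep[OF assms(1) _ refl] s by blast
qed

text \<open>For either value at \<open>v\<close> the part of the covariance times the probability of
  that value is \<open>cov i v * cov j v\<close>, because the signs in \<open>expec_at_Z\<close>
  cancel. Weighting each equation with the opposite probability and adding gives the product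
  rule.\<close>

lemma cov_separated:
  assumes "v \<in> V" "i \<in> V" "j \<in> V" "separated v i j"
  shows "cov i j * var v = cov i v * cov j v" "var v = 0 \<Longrightarrow> cov i j = 0"
proof -
  let ?f = "\<lambda>\<alpha>. Z i \<alpha> * Z j \<alpha>"
  have "expec_at v s ?f * expec_at v s (\<lambda>_. 1) = expec_at v s (Z i) * expec_at v s (Z j)"
    if "s = 0 \<or> s = 1" for s
    using assms that by (intro cond_indep_separated[of v i "{j}"]) (auto simp: depends_on_def Z_def)
  from this[of 0] this[of 1]
  have *: "expec_at v 0 ?f * (1 - mean v) = cov i v * cov j v"
    "expec_at v 1 ?f * mean v = cov i v * cov j v"
    using assms by (simp_all add: expec_at_prob[OF assms(1)] expec_at_Z[OF assms(1)] del: One_nat_def)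
  have sum: "cov i j = expec_at v 0 ?f + expec_at v 1 ?f"
    unfolding cov_def by (rule expec_split[OF assms(1)])
  have eq: "cov i j * var v = (expec_at v 0 ?f * (1 - mean v)) * mean v + (expec_at v 1 ?f * mean v) * (1 - mean v)"
    by (simp add: sum var_def algebra_simps)
  show "cov i j * var v = cov i v * cov j v"
    unfolding eq * by (simp add: algebra_simps)
  assume "var v = 0"
  \<comment> \<open>The equation for the value of probability zero forces
    \<open>cov i v * cov j v = 0\<close>; then the other equation makes the remaining part vanish
    too.\<close>
  then consider "mean v = 0" | "mean v = 1" by (auto simp: var_def)
  then show "cov i j = 0"
  proof cases
    case 1
    then have "expec_at v 1 ?f = 0" using expec_at_null expec_at_prob assms by metis
    then show ?thesis using * sum 1 by simp
  next
    case 2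
    then have "expec_at v 0 ?f = 0" using expec_at_null expec_at_prob(2) assms by simp
    then show ?thesis using * sum 2 by simp
  qed
qed

text \<open>First \<open>i\<close> is split from \<open>j\<close> and \<open>k\<close>, then
  \<open>j\<close> from \<open>k\<close>. With three factors the signs at the values 0 and 1 differ,
  and \<open>(1 - m)^2 - m^2 = 1 - 2 * m\<close> for \<open>m = mean v\<close>.\<close>

lemma cov3_separated:
  assumes V: "v \<in> V" "i \<in> V" "j \<in> V" "k \<in> V"
    and sep: "separated v i j" "separated v i k" "separated v j k"
  shows "cov3 i j k * (var v)\<^sup>2 = cov i v * cov j v * cov k v * (1 - 2 * mean v)"
proof -
  let ?g = "\<lambda>\<alpha>. Z j \<alpha> * Z k \<alpha>" and ?f = "\<lambda>\<alpha>. Z i \<alpha> * (Z j \<alpha> * Z k \<alpha>)"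
  have *: "expec_at v s ?f * (expec_at v s (\<lambda>_. 1))\<^sup>2 = expec_at v s (Z i) * expec_at v s (Z j) * expec_at v s (Z k)"
    if "s = 0 \<or> s = 1" for s
  proof -
    have f: "expec_at v s ?f * expec_at v s (\<lambda>_. 1) = expec_at v s (Z i) * expec_at v s ?g"
      using V sep that
      by (intro cond_indep_separated[of v i "{j, k}"]) (auto simp: depends_on_def Z_def)
    have g: "expec_at v s ?g * expec_at v s (\<lambda>_. 1) = expec_at v s (Z j) * expec_at v s (Z k)"
      using V sep that
      by (intro cond_indep_separated[of v j "{k}"]) (auto simp: depends_on_def Z_def)
    have "expec_at v s ?f * (expec_at v s (\<lambda>_. 1))\<^sup>2 = expec_at v s (Z i) * (expec_at v s ?g * expec_at v s (\<lambda>_. 1))"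
      using f by (simp add: power2_eq_square flip: mult.assoc)
    then show ?thesis by (simp only: g mult.assoc)
  qed
  let ?p = "cov i v * cov j v * cov k v"
  have e: "expec_at v 0 ?f * (1 - mean v)\<^sup>2 = - ?p" "expec_at v 1 ?f * (mean v)\<^sup>2 = ?p"
    using *[of 0] *[of 1] by (simp_all add: expec_at_prob[OF V(1)] expec_at_Z[OF V(1)] del: One_nat_def)
  have "cov3 i j k = expec_at v 0 ?f + expec_at v 1 ?f"
    unfolding cov3_def mult.assoc by (rule expec_split[OF V(1)])
  then have "cov3 i j k * (var v)\<^sup>2 =
      (expec_at v 0 ?f * (1 - mean v)\<^sup>2) * (mean v)\<^sup>2 + (expec_at v 1 ?f * (mean v)\<^sup>2) * (1 - mean v)\<^sup>2"
    unfolding var_def power_mult_distrib by (simp add: algebra_simps)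
  then show ?thesis unfolding e by (simp add: power2_eq_square algebra_simps)
qed

end

section \<open>Moments and tree parameters\<close>

text \<open>\<open>N\<close> is the edge set of the \<open>p\<close>-forest as a symmetric relation.\<close>

locale leaf_model = tree_model +
  fixes L :: "nat set" and N :: "nat rel"
  assumes no_cycle_E: "\<And>a p b. spath E a p b \<Longrightarrow> 3 \<le> length p \<Longrightarrow> (b, a) \<notin> E"
    and L_subset: "L \<subseteq> V"
    and var_leaf: "\<And>i. i \<in> L \<Longrightarrow> var i \<noteq> 0"
    and N_def: "N = {(a, b) \<in> E. \<exists>i\<in>L. \<exists>j\<in>L. \<exists>p. i \<noteq> j \<and> spath E i p j \<and>
      traverses p (a, b) \<and> cov i j \<noteq> 0}"
    and inner_degree: "\<And>v. v \<in> V - L \<Longrightarrow> \<exists>y y'. y \<noteq> y' \<and> (v, y) \<in> N \<and> (v, y') \<in> N"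
begin

sublocale acyclic_graph E
proof
  show "(a, a) \<notin> E" for a
    using pa_neq by (auto simp: E_def)
qed (use sym_E no_cycle_E in auto)

lemma connected_E: "a \<in> V \<Longrightarrow> b \<in> V \<Longrightarrow> (a, b) \<in> E\<^sup>*"
proof -
  have root: "(v, r) \<in> E\<^sup>*" if "v \<in> V" for v
    using that
  proof (induction "dep v" arbitrary: v rule: less_induct)
    case less
    show ?case
    proof (cases "v = r")
      case False
      then have "(v, pa v) \<in> E" "(pa v, r) \<in> E\<^sup>*"
        using less dep_pa pa_in_V by (auto simp: E_def)
      then show ?thesis by (rule converse_rtrancl_into_rtrancl)
    qed simp
  qed
  show "(a, b) \<in> E\<^sup>*" if "a \<in> V" "b \<in> V"
    using root[OF that(1)] root[OF that(2)] sym_rtrancl[OF sym_E]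
    by (meson rtrancl_trans symD)
qed

section \<open>Correlation along paths of the tree\<close>

lemma path_separated:
  "spath E a p b \<Longrightarrow> v \<in> set p \<Longrightarrow> a \<noteq> v \<Longrightarrow> b \<noteq> v \<Longrightarrow> separated v a b"
  using on_path_imp_separated by (auto simp: separated_def)

lemma path_subset_V: "spath E a p b \<Longrightarrow> a \<in> V \<Longrightarrow> set p \<subseteq> V"
  by (rule spath_set_subset[OF _ E_subset])

text \<open>With \<open>?y\<close> the second node,
  \<open>cov a b * var ?y = cov a ?y * cov ?y b\<close>, so the claim follows by induction. For a
  single node the covariance is its nonzero variance.\<close>

lemma cov_path:
  assumes "spath E a p b" "a \<in> V" "\<And>w. w \<in> set p \<Longrightarrow> var w \<noteq> 0"
  shows "cov a b \<noteq> 0 \<longleftrightarrow> (\<forall>(x, y)\<in>set (vwalk_arcs p). cov x y \<noteq> 0)"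
  using assms
proof (induction p arbitrary: a)
  case Nil
  then show ?case by (simp add: spath_def)
next
  case (Cons x p)
  show ?case
  proof (cases "p = []")
    case True
    then show ?thesis using Cons.prems by (auto simp: cov_self)
  next
    case False
    let ?y = "hd p"
    have p: "a = x" "x \<notin> set p" "(x, ?y) \<in> E" "spath E ?y p b"
      using Cons.prems False by (auto simp: spath_Cons)
    have V: "?y \<in> V" "b \<in> V"
      using path_subset_V[OF Cons.prems(1,2)] False spath_ends[OF p(4)] by auto
    have IH: "cov ?y b \<noteq> 0 \<longleftrightarrow> (\<forall>(x, y)\<in>set (vwalk_arcs p). cov x y \<noteq> 0)"
      using Cons.IH[OF p(4) V(1)] Cons.prems by auto
    have vy: "var ?y \<noteq> 0" using Cons.prems False by auto
    have "cov a b * var ?y = cov a ?y * cov ?y b"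
    proof (cases "b = ?y")
      case True
      then show ?thesis using V by (simp add: cov_self)
    next
      case False
      have "separated ?y a b"
        using p False \<open>p \<noteq> []\<close> by (intro path_separated[OF Cons.prems(1)]) auto
      then show ?thesis using cov_separated(1)[OF V(1) Cons.prems(2) V(2)] cov_sym by simp
    qed
    then have "cov a b \<noteq> 0 \<longleftrightarrow> cov a ?y \<noteq> 0 \<and> cov ?y b \<noteq> 0" using vy by auto
    then show ?thesis using IH False p(1) by auto
  qed
qed

lemma N_subset: "N \<subseteq> E"
  by (auto simp: N_def)

text \<open>A forest edge at an inner node puts it on a path between two correlated leaves. A
  degenerate node there would make them uncorrelated.\<close>

lemma var_nonzero:
  assumes "v \<in> V"
  shows "var v \<noteq> 0"
proof (cases "v \<in> L")
  case False
  then obtain y where "(v, y) \<in> N" using inner_degree assms by blast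
  then obtain i j p where p: "i \<in> L" "j \<in> L" "spath E i p j" "cov i j \<noteq> 0"
    and tr: "traverses p (v, y)"
    by (auto simp: N_def)
  have "v \<in> set p"
    using tr by (auto simp: traverses_def elim: in_set_vwalk_arcsE)
  then have "separated v i j" using p False by (intro path_separated) auto
  then show ?thesis using cov_separated(2) p assms L_subset by blast
qed (rule var_leaf)

lemma cov_path_nonzero:
  assumes "spath E a p b" "a \<in> V"
  shows "cov a b \<noteq> 0 \<longleftrightarrow> (\<forall>(x, y)\<in>set (vwalk_arcs p). cov x y \<noteq> 0)"
  using var_nonzero path_subset_V[OF assms] by (intro cov_path[OF assms]) blast

text \<open>The edge lies on a path with correlated ends, so \<open>cov_path_nonzero\<close> applies
  to it; symmetry settles the direction of traversal.\<close>

lemma N_cov: "(a, b) \<in> N \<Longrightarrow> cov a b \<noteq> 0"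
proof -
  assume "(a, b) \<in> N"
  then obtain i j p where p: "i \<in> L" "spath E i p j" "cov i j \<noteq> 0" "traverses p (a, b)"
    by (auto simp: N_def)
  then have "cov a b \<noteq> 0 \<or> cov b a \<noteq> 0"
    using cov_path_nonzero[OF p(2)] L_subset by (auto simp: traverses_def)
  then show ?thesis using cov_sym[of a b] by simp
qed

text \<open>A longest path through \<open>(a, b)\<close> among those whose edges all carry correlation ends in two
  leaves, since an inner end would have a second correlated edge.\<close>

lemma cov_imp_N:
  assumes "(a, b) \<in> E" "cov a b \<noteq> 0"
  shows "(a, b) \<in> N"
proof -
  define R where "R = {(x, y) \<in> E. cov x y \<noteq> 0}"
  have symR: "sym R" using sym_E cov_sym by (auto simp: R_def sym_def)
  have RE: "R \<subseteq> E" by (auto simp: R_def)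
  have NR: "N \<subseteq> R" using N_cov N_subset by (auto simp: R_def)
  \<comment> \<open>These are the candidates for a longest path; distinct nodes bound their length
    by \<open>card V\<close>.\<close>
  define good where "good p \<longleftrightarrow> spath R (hd p) p (last p) \<and> traverses p (a, b)" for p
  have "a \<noteq> b" using no_loop assms by blast
  then have g0: "good [a, b]"
    using assms by (auto simp: good_def spath_def traverses_def R_def)
  have in_V: "set p \<subseteq> V" "2 \<le> length p" if "good p" for p
  proof -
    show len: "2 \<le> length p"
      using that by (cases p; cases "tl p") (auto simp: good_def traverses_def)
    have sp: "spath E (hd p) p (last p)" using that RE spath_mono by (auto simp: good_def)
    then have "hd p \<in> V" using len E_subset by (cases p; cases "tl p") (auto simp: spath_def)
    then show "set p \<subseteq> V" using path_subset_V[OF sp] by blast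
  qed
  have "length p < Suc (card V)" if "good p" for p
    using that card_mono[OF finite_V in_V(1)[OF that]] distinct_card[of p]
    by (simp add: good_def spath_def le_imp_less_Suc)
  then obtain p where p: "good p" "\<And>q. good q \<Longrightarrow> length q \<le> length p"
    using ex_has_greatest_nat[of good "[a, b]" length "Suc (card V)"] g0 by metis
  \<comment> \<open>Stated for every longest candidate, so that applying it to the reversed path
    treats the first node.\<close>
  have end_leaf: "last p \<in> L"
    if p: "good p" "\<And>q. good q \<Longrightarrow> length q \<le> length p" for p
  proof (rule ccontr)
    assume "last p \<notin> L"
    moreover have "p \<noteq> []" using in_V(2)[OF p(1)] by auto
    ultimately obtain y y' where y: "(last p, y) \<in> R" "(last p, y') \<in> R" "y \<noteq> y'"
      using inner_degree NR in_V(1)[OF p(1)] by (metis DiffI last_in_set subset_iff)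
    have max: "q = []" if "spath R (hd p) (p @ q) (last (p @ q))" for q
    proof -
      \<comment> \<open>An extension still traverses \<open>(a, b)\<close>, hence it is no longer
        than \<open>p\<close> and \<open>q\<close> is empty.\<close>
      have "good (p @ q)"
        using that p(1) set_vwalk_arcs_append1[of p q] \<open>p \<noteq> []\<close>
        by (auto simp: good_def traverses_def)
      then show ?thesis using p(2) by fastforce
    qed
    have "spath R (hd p) p (last p)" using p(1) by (simp add: good_def)
    from maximal_path_end[OF this in_V(2)[OF p(1)] RE max y] show False .
  qed
  have "good (rev p)"
    using p(1) spath_rev[OF symR] by (auto simp: good_def traverses_def set_vwalk_arcs_rev hd_rev last_rev)
  then have "last (rev p) \<in> L" using p by (intro end_leaf) auto
  then have ends: "hd p \<in> L" "last p \<in> L"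
    using end_leaf p by (auto simp: last_rev)
  have neq: "hd p \<noteq> last p"
    using p(1) in_V(2)[OF p(1)] by (cases p) (auto simp: good_def spath_def split: if_splits)
  have sp: "spath E (hd p) p (last p)" using p(1) RE spath_mono by (auto simp: good_def)
  moreover have "cov (hd p) (last p) \<noteq> 0"
    using cov_path_nonzero[OF sp] ends L_subset p(1) by (auto simp: good_def spath_def R_def)
  ultimately show ?thesis
    using ends neq p(1) assms unfolding N_def good_def by blast
qed

section \<open>Formulas for the squared parameters\<close>

lemma cumulant_identity:
  assumes V: "v \<in> V" "i \<in> V" "j \<in> V" "k \<in> V"
    and sep: "separated v i j" "separated v i k" "separated v j k"
  shows "(cov3 i j k)\<^sup>2 + 4 * cov i j * cov i k * cov j k =
      (cov i v * cov j v * cov k v)\<^sup>2 / (var v) ^ 4"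
    "(cov3 i j k)\<^sup>2 = (1 - 2 * mean v)\<^sup>2 * (cov i v * cov j v * cov k v)\<^sup>2 / (var v) ^ 4"
proof -
  let ?x = "cov i v" and ?y = "cov j v" and ?z = "cov k v" and ?u = "var v"
  have u: "?u \<noteq> 0" using var_nonzero V by blast
  have c2: "cov i j = ?x * ?y / ?u" "cov i k = ?x * ?z / ?u" "cov j k = ?y * ?z / ?u"
    using cov_separated(1)[OF V(1,2,3) sep(1)] cov_separated(1)[OF V(1,2,4) sep(2)]
      cov_separated(1)[OF V(1,3,4) sep(3)] u by (simp_all add: field_simps)
  have c3: "cov3 i j k = ?x * ?y * ?z * (1 - 2 * mean v) / ?u\<^sup>2"
    using cov3_separated[OF V sep] u by (simp add: field_simps)
  \<comment> \<open>Apart from a common factor the two summands of the first claim are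
    \<open>(1 - 2 * mean v)^2\<close> and \<open>4 * var v\<close>, which add up to one.\<close>
  have m: "(1 - 2 * mean v)\<^sup>2 + 4 * ?u = 1"
    by (simp add: var_def power2_eq_square algebra_simps)
  show c3': "(cov3 i j k)\<^sup>2 = (1 - 2 * mean v)\<^sup>2 * (?x * ?y * ?z)\<^sup>2 / ?u ^ 4"
    unfolding c3 by (simp add: power_mult_distrib power_divide mult_ac flip: power_mult)
  have "4 * cov i j * cov i k * cov j k = 4 * ?u * (?x * ?y * ?z)\<^sup>2 / ?u ^ 4"
    unfolding c2 using u by (simp add: field_simps power2_eq_square power4_eq_xxxx)
  then have "(cov3 i j k)\<^sup>2 + 4 * cov i j * cov i k * cov j k =
      ((1 - 2 * mean v)\<^sup>2 + 4 * ?u) * (?x * ?y * ?z)\<^sup>2 / ?u ^ 4"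
    unfolding c3' by (simp add: distrib_right add_divide_distrib)
  then show "(cov3 i j k)\<^sup>2 + 4 * cov i j * cov i k * cov j k = (?x * ?y * ?z)\<^sup>2 / ?u ^ 4"
    unfolding m by simp
qed

lemma node_formula:
  assumes V: "v \<in> V" "i \<in> V" "j \<in> V" "k \<in> V"
    and sep: "separated v i j" "separated v i k" "separated v j k"
    and nz: "cov i j * cov i k * cov j k \<noteq> 0"
  shows "(1 - 2 * mean v)\<^sup>2 =
    (cov3 i j k)\<^sup>2 / ((cov3 i j k)\<^sup>2 + 4 * cov i j * cov i k * cov j k)"
proof -
  have "cov i v \<noteq> 0" "cov j v \<noteq> 0" "cov k v \<noteq> 0"
    using nz cov_separated(1)[OF V(1,2,3) sep(1)] cov_separated(1)[OF V(1,2,4) sep(2)]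
      var_nonzero[OF V(1)] by auto
  then show ?thesis
    using var_nonzero[OF V(1)] unfolding cumulant_identity(1)[OF V sep] unfolding cumulant_identity(2)[OF V sep] by simp
qed

text \<open>For an edge from \<open>v\<close> to \<open>i\<close> the left-hand side is the squared
  edge parameter, by \<open>cov_parent\<close>.\<close>

lemma pendant_formula:
  assumes V: "v \<in> V" "i \<in> V" "j \<in> V" "k \<in> V"
    and sep: "separated v i j" "separated v i k" "separated v j k"
    and nz: "cov j k \<noteq> 0"
  shows "(cov i v / var v)\<^sup>2 =
    ((cov3 i j k)\<^sup>2 + 4 * cov i j * cov i k * cov j k) / (cov j k)\<^sup>2"
proof -
  have u: "var v \<noteq> 0" using var_nonzero V by blast
  have jk: "cov j k = cov j v * cov k v / var v"
    using cov_separated(1)[OF V(1,3,4) sep(3)] u by (simp add: field_simps)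
  then have "cov j v \<noteq> 0" "cov k v \<noteq> 0" using nz by auto
  then show ?thesis
    unfolding cumulant_identity(1)[OF V sep] unfolding jk using u
    by (simp add: field_simps power2_eq_square power4_eq_xxxx)
qed

text \<open>In the quotient of the identities at \<open>u\<close> and at \<open>v\<close> the
  factors of \<open>i\<close>, \<open>j\<close> and \<open>l\<close> cancel against those of
  \<open>cov i l\<close> and \<open>cov i j\<close>. What remains involves
  \<open>cov k u / cov k v\<close>, and as \<open>v\<close> separates \<open>k\<close> from
  \<open>u\<close> this is \<open>cov u v / var v\<close>.\<close>

lemma inner_edge_formula:
  assumes V: "u \<in> V" "v \<in> V" "i \<in> V" "j \<in> V" "k \<in> V" "l \<in> V"
    and sep_u: "separated u i j" "separated u i k" "separated u j k"
    and sep_v: "separated v i k" "separated v i l" "separated v k l"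
    and uv: "separated v k u"
    and nz: "cov i j \<noteq> 0" "cov i k \<noteq> 0" "cov i l \<noteq> 0"
  shows "(cov u v / var u)\<^sup>2 = (cov i l)\<^sup>2 / (cov i j)\<^sup>2 *
    (((cov3 i j k)\<^sup>2 + 4 * cov i j * cov i k * cov j k) /
     ((cov3 i k l)\<^sup>2 + 4 * cov i k * cov i l * cov k l))"
proof -
  have U: "var u \<noteq> 0" "var v \<noteq> 0" using var_nonzero V by auto
  have ij: "cov i j = cov i u * cov j u / var u"
    using cov_separated(1)[OF V(1,3,4) sep_u(1)] U by (simp add: field_simps)
  have ik: "cov i k = cov i v * cov k v / var v"
    using cov_separated(1)[OF V(2,3,5) sep_v(1)] U by (simp add: field_simps)
  have il: "cov i l = cov i v * cov l v / var v"
    using cov_separated(1)[OF V(2,3,6) sep_v(2)] U by (simp add: field_simps)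
  have ku: "cov k u = cov k v * cov u v / var v"
    using cov_separated(1)[OF V(2,5,1) uv] U by (simp add: field_simps)
  have nz': "cov i u \<noteq> 0" "cov j u \<noteq> 0" "cov i v \<noteq> 0" "cov k v \<noteq> 0" "cov l v \<noteq> 0"
    using nz ij ik il by auto
  show ?thesis
    unfolding cumulant_identity(1)[OF V(1,3,4,5) sep_u] cumulant_identity(1)[OF V(2,3,5,6) sep_v]
    unfolding ij il ku using nz' U
    by (simp add: field_simps power2_eq_square power4_eq_xxxx)
qed

text \<open>A path of the forest is the unique path of the tree between its ends. The existence
  assumption keeps the condition on forest paths from being vacuous.\<close>

lemma N_path_separated:
  assumes "\<exists>p. spath N a p b" "\<And>p. spath N a p b \<Longrightarrow> w \<in> set p" "a \<noteq> w" "b \<noteq> w"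
  shows "separated w a b"
proof -
  obtain p where p: "spath N a p b" using assms(1) by blast
  show ?thesis
    using path_separated[OF spath_mono[OF p N_subset] assms(2)[OF p] assms(3,4)] .
qed

lemma N_path_cov:
  assumes "\<exists>p. spath N a p b" "a \<in> V"
  shows "cov a b \<noteq> 0"
proof -
  obtain p where p: "spath N a p b" using assms by blast
  then show ?thesis
    using cov_path_nonzero[OF spath_mono[OF p N_subset] assms(2)] N_cov
    by (auto simp: spath_def)
qed

lemma separated_trans: "(a, b) \<in> (avoid E v)\<^sup>* \<Longrightarrow> separated v a d \<Longrightarrow> separated v b d"
  using avoid_reachable_neq[of a b E v] rtrancl_trans[of a b "avoid E v" d]
  by (auto simp: separated_def)

text \<open>The assumptions say that paths meet both \<open>u\<close> and \<open>v\<close> but not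
  in which order. The order needed for \<open>inner_edge_formula\<close>, with \<open>v\<close>
  between \<open>u\<close> and \<open>k\<close>, is derived here.\<close>

lemma edge_separates_formula:
  assumes u: "u \<in> V - L" and v: "v \<in> V - L" and uv: "u \<noteq> v"
    and L: "i \<in> L" "j \<in> L" "k \<in> L" "l \<in> L"
    and conn: "\<And>a b. a \<in> {i, j, k, l} \<Longrightarrow> b \<in> {i, j, k, l} \<Longrightarrow> \<exists>p. spath N a p b"
    and sep_u: "\<And>p. spath N i p j \<Longrightarrow> u \<in> set p"
    and sep_v: "\<And>p. spath N k p l \<Longrightarrow> v \<in> set p"
    and sep_uv: "\<And>a b p. a \<in> {i, j} \<Longrightarrow> b \<in> {k, l} \<Longrightarrow> spath N a p b \<Longrightarrow> u \<in> set p \<and> v \<in> set p"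
  shows "(cov u v / var u)\<^sup>2 = (cov i l)\<^sup>2 / (cov i j)\<^sup>2 *
    (((cov3 i j k)\<^sup>2 + 4 * cov i j * cov i k * cov j k) /
     ((cov3 i k l)\<^sup>2 + 4 * cov i k * cov i l * cov k l))"
proof -
  have V: "i \<in> V" "j \<in> V" "k \<in> V" "l \<in> V" using L L_subset by auto
  have ne: "i \<noteq> u" "j \<noteq> u" "k \<noteq> u" "l \<noteq> u" "i \<noteq> v" "j \<noteq> v" "k \<noteq> v" "l \<noteq> v"
    using L u v by auto
  have su: "separated u i j" "separated u i k" "separated u j k"
    using conn sep_u sep_uv ne by (intro N_path_separated; force)+
  have sv: "separated v i k" "separated v i l" "separated v j k" "separated v k l"
    using conn sep_v sep_uv ne by (intro N_path_separated; force)+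
  \<comment> \<open>Otherwise \<open>k\<close> and \<open>u\<close> are on the same side of
    \<open>v\<close>, so \<open>i\<close> and \<open>j\<close>, which \<open>v\<close> separates
    from \<open>k\<close>, must pass \<open>v\<close> to reach \<open>u\<close>. Then both reach
    \<open>v\<close> without \<open>u\<close>, although \<open>u\<close> separates them.\<close>
  have "separated v k u"
  proof (rule ccontr)
    assume "\<not> separated v k u"
    then have ku: "(k, u) \<in> (avoid E v)\<^sup>*" using ne uv by (auto simp: separated_def)
    have "(a, v) \<in> (avoid E u)\<^sup>*" if a: "a \<in> {i, j}" for a
    proof (rule separated_swap)
      have "separated v k a" using a sv separated_sym by blast
      then show "(a, u) \<notin> (avoid E v)\<^sup>*"
        using separated_trans[OF ku] separated_sym separated_def by blast
    qed (use a V u ne uv connected_E in auto)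
    then have "(i, v) \<in> (avoid E u)\<^sup>*" "(v, j) \<in> (avoid E u)\<^sup>*"
      using sym_rtrancl[OF sym_avoid[OF sym_E]] by (auto dest: symD)
    then show False using su(1) by (auto simp: separated_def dest: rtrancl_trans)
  qed
  then show ?thesis
    using u v V su sv conn N_path_cov by (intro inner_edge_formula) auto
qed

end

section \<open>Rooted trees\<close>

definition undirected :: "nat pair_pre_digraph \<Rightarrow> nat rel" where
  "undirected G = parcs G \<union> (parcs G)\<inverse>"

lemma parcs_mk_symmetric_pair: "parcs (mk_symmetric (with_proj G)) = undirected G"
  by (auto simp: undirected_def parcs_mk_symmetric)

lemma upath_iff: "upath G a p b \<longleftrightarrow> set p \<subseteq> pverts G \<and> spath (undirected G) a p b"
  by (auto simp: upath_def vpath_def vwalk_def spath_def parcs_mk_symmetric_pair)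

lemma upath_iff_start:
  assumes "undirected G \<subseteq> pverts G \<times> pverts G" "a \<in> pverts G"
  shows "upath G a p b \<longleftrightarrow> spath (undirected G) a p b"
  using spath_set_subset[OF _ assms] by (auto simp: upath_iff)

lemma udegree_eq: "udegree G v = card {e \<in> undirected G. fst e = v}"
  by (simp add: udegree_def out_degree_def out_arcs_def parcs_mk_symmetric_pair)

lemma vwalk_arcs_split: "(u, v) \<in> set (vwalk_arcs p) \<Longrightarrow> \<exists>q s. p = q @ u # v # s"
proof (induction p rule: vwalk_arcs.induct)
  case (3 x y xs)
  then show ?case by (auto intro: exI[of _ "[]"]) (metis append_Cons)
qed auto

lemma traverses_swap: "traverses p (a, b) \<longleftrightarrow> traverses p (b, a)"
  by (auto simp: traverses_def)

lemma traverses_nodes: "traverses p (u, v) \<Longrightarrow> u \<in> set p \<and> v \<in> set p"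
  by (auto simp: traverses_def elim: in_set_vwalk_arcsE)

lemma card_ge_2_obtain:
  assumes "2 \<le> card S"
  obtains x y where "x \<in> S" "y \<in> S" "x \<noteq> y"
  using assms card_le_Suc0_iff_eq[of S] card.infinite[of S] by force

section \<open>Parents and depths in a rooted tree\<close>

context
  fixes T :: "nat pair_pre_digraph" and r :: nat
  assumes rooted: "rooted_tree T r"
begin

lemma undirected_subset: "undirected T \<subseteq> pverts T \<times> pverts T"
proof -
  interpret pair_digraph T using rooted by (simp add: rooted_tree_def)
  show ?thesis using in_arcsD1 in_arcsD2 by (auto simp: undirected_def)
qed

lemma finite_pverts: "finite (pverts T)"
proof -
  interpret pair_digraph T using rooted by (simp add: rooted_tree_def)
  show ?thesis by (rule pair_finite_verts)
qed

lemma acyclic_undirected: "acyclic_graph (undirected T)"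
proof
  show "sym (undirected T)" by (auto simp: undirected_def sym_def)
  show "(a, a) \<notin> undirected T" for a
    using rooted by (auto simp: undirected_def rooted_tree_def)
  show "(b, a) \<notin> undirected T" if p: "spath (undirected T) a p b" and len: "3 \<le> length p" for a p b
  proof
    assume ba: "(b, a) \<in> undirected T"
    then have "set p \<subseteq> pverts T"
      using spath_set_subset[OF p undirected_subset] undirected_subset by blast
    then have "ucycle T p"
      using p len ba
      by (auto simp: ucycle_def vpath_def vwalk_def spath_def parcs_mk_symmetric_pair)
    then show False using rooted by (auto simp: rooted_tree_def)
  qed
qed

interpretation acyclic_graph "undirected T"
  by (rule acyclic_undirected)

text \<open>The number of nodes, not edges, of the unique path from the root.\<close>

definition depth :: "nat \<Rightarrow> nat" where
  "depth v = length (THE p. spath (undirected T) r p v)"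

lemma depth_eq: "spath (undirected T) r p v \<Longrightarrow> depth v = length p"
  unfolding depth_def using spath_unique by (metis the_equality)

text \<open>The path along which the edge points away from the root ends in \<open>v\<close> and
  does not repeat it, so \<open>u\<close> and \<open>v\<close> are its last two nodes.\<close>

lemma path_to_child:
  assumes "(u, v) \<in> parcs T"
  shows "\<exists>q. spath (undirected T) r q u \<and> spath (undirected T) r (q @ [v]) v"
proof -
  obtain p where p: "upath T r p v" "(u, v) \<in> set (vwalk_arcs p)"
    using rooted assms unfolding rooted_tree_def by blast
  then obtain q s where qs: "p = q @ u # v # s" using vwalk_arcs_split by metis
  have sp: "spath (undirected T) r p v" using p by (simp add: upath_iff)
  have "s = []"
    using sp last_in_set[of s] by (auto simp: qs spath_def split: if_splits)
  then have "p = (q @ [u]) @ [v]" using qs by simp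
  moreover have "spath (undirected T) r (q @ [u]) u"
    using sp unfolding qs by (rule spath_prefix)
  ultimately show ?thesis using sp by metis
qed

text \<open>A parent is the last node but one of the only path from the root.\<close>

lemma parent_unique:
  assumes "(u, v) \<in> parcs T" "(u', v) \<in> parcs T"
  shows "u = u'"
proof -
  obtain q q' where q: "spath (undirected T) r q u" "spath (undirected T) r (q @ [v]) v"
    "spath (undirected T) r q' u'" "spath (undirected T) r (q' @ [v]) v"
    using path_to_child assms by meson
  then have "q = q'" using spath_unique[OF q(2) q(4)] by simp
  then show ?thesis using q by (auto simp: spath_def)
qed

lemma depth_child: "(u, v) \<in> parcs T \<Longrightarrow> depth v = Suc (depth u)"
  using path_to_child[of u v] depth_eq by force

lemma parent_eq: "(u, v) \<in> parcs T \<Longrightarrow> parent T v = u"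
  unfolding parent_def using parent_unique by blast

text \<open>The predecessor of \<open>v\<close> on the path from the root is adjacent to
  \<open>v\<close>. An edge from \<open>v\<close> to it would contradict the depths, so the edge
  points to \<open>v\<close>.\<close>

lemma parent_arc:
  assumes "v \<in> pverts T" "v \<noteq> r"
  shows "(parent T v, v) \<in> parcs T"
proof -
  have "(r, v) \<in> (undirected T)\<^sup>*"
    using rooted assms reachable_rtranclI[of "with_proj (mk_symmetric (with_proj T))" r v]
    by (simp add: rooted_tree_def Digraph_Component.connected_def strongly_connected_def parcs_mk_symmetric_pair)
  then obtain p where p: "spath (undirected T) r p v" using rtrancl_imp_spath by metis
  obtain q where pq: "p = q @ [v]"
    using p by (cases p rule: rev_cases) (auto simp: spath_def)
  moreover have "q \<noteq> []" using p assms by (auto simp: pq spath_def)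
  ultimately have pq: "p = q @ [v]" "q \<noteq> []" by simp_all
  then have q: "(last q, v) \<in> undirected T" "spath (undirected T) r q (last q)"
    using p by (auto simp: spath_append)
  have "(v, last q) \<notin> parcs T"
    using depth_child[of v "last q"] depth_eq[OF q(2)] depth_eq[OF p] pq by auto
  then have "(last q, v) \<in> parcs T" using q by (simp add: undirected_def)
  then show ?thesis using parent_eq by metis
qed

lemma root_no_parent: "(u, r) \<notin> parcs T"
proof
  assume "(u, r) \<in> parcs T"
  then obtain q where q: "spath (undirected T) r q u" "spath (undirected T) r (q @ [r]) r"
    using path_to_child by metis
  have "q @ [r] = [r]" by (rule spath_unique[OF q(2)]) simp
  then show False using q by (simp add: spath_def)
qed

lemma parcs_iff: "(u, v) \<in> parcs T \<longleftrightarrow> v \<in> pverts T \<and> v \<noteq> r \<and> u = parent T v"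
proof
  assume uv: "(u, v) \<in> parcs T"
  then have "v \<in> pverts T" using undirected_subset by (auto simp: undirected_def)
  then show "v \<in> pverts T \<and> v \<noteq> r \<and> u = parent T v"
    using uv parent_eq root_no_parent by auto
qed (use parent_arc in simp)

lemma parent_in_pverts: "v \<in> pverts T \<Longrightarrow> v \<noteq> r \<Longrightarrow> parent T v \<in> pverts T"
  using parent_arc undirected_subset by (auto simp: undirected_def)

lemma tree_model_cond_prob:
  assumes "\<theta> \<in> Theta T"
  shows "tree_model (pverts T) r (parent T) depth (cond_prob T r \<theta>)"
proof
  show "finite (pverts T)" by (rule finite_pverts)
  show "r \<in> pverts T" using rooted by (simp add: rooted_tree_def)
  fix v assume v: "v \<in> pverts T"
  show "parent T v \<in> pverts T" if "v \<noteq> r" using v that by (rule parent_in_pverts)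
  show "depth (parent T v) < depth v" if "v \<noteq> r"
    using depth_child[OF parent_arc[OF v that]] by simp
  fix b :: nat assume b: "v \<noteq> r \<Longrightarrow> b = 0 \<or> b = 1"
  show "cond_prob T r \<theta> v 0 b + cond_prob T r \<theta> v 1 b = 1"
    by (simp add: cond_prob_def Let_def)
  have \<theta>: "fst \<theta> \<in> {0..1}" "snd \<theta> \<in> (parcs T \<times> {0, 1}) \<rightarrow>\<^sub>E {0..1}"
    using assms unfolding Theta_def mem_Times_iff by blast+
  have "snd \<theta> ((parent T v, v), b) \<in> {0..1}" if "v \<noteq> r"
    by (rule PiE_mem[OF \<theta>(2)]) (use parent_arc[OF v that] b[OF that] in simp)
  then show "0 \<le> cond_prob T r \<theta> v a b" for a
    using \<theta>(1) by (cases "v = r") (simp_all add: cond_prob_def Let_def)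
qed (simp add: cond_prob_def)

lemma undirected_eq_tree_model:
  assumes "\<theta> \<in> Theta T"
  shows "tree_model.E (pverts T) r (parent T) = undirected T"
  unfolding tree_model.E_def[OF tree_model_cond_prob[OF assms]]
  by (auto simp: undirected_def parcs_iff)

end

section \<open>The fiber\<close>

text \<open>The assignments to all nodes are grouped by their restriction to the leaves, so moments
  of the leaf distribution become moments of the full model.\<close>

lemma expect_model_map:
  assumes "finite (pverts T)" "leaves T = {1..n}"
  shows "expect n (model_map T r \<theta>) g =
    (\<Sum>\<alpha>\<in>cube (pverts T). joint_prob T r \<theta> \<alpha> * g (restrict \<alpha> {1..n}))"
proof -
  have sub: "{1..n} \<subseteq> pverts T" using assms(2) by (auto simp: leaves_def)
  have "expect n (model_map T r \<theta>) g = (\<Sum>x\<in>cube {1..n}.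
      \<Sum>\<alpha> | \<alpha> \<in> cube (pverts T) \<and> restrict \<alpha> {1..n} = x.
        joint_prob T r \<theta> \<alpha> * g (restrict \<alpha> {1..n}))"
    by (simp add: expect_def model_map_def assms(2) sum_distrib_right)
  also have "\<dots> = (\<Sum>\<alpha>\<in>cube (pverts T). joint_prob T r \<theta> \<alpha> * g (restrict \<alpha> {1..n}))"
    by (rule sum.group) (use assms(1) sub in \<open>auto simp: finite_PiE PiE_iff subset_iff\<close>)
  finally show ?thesis .
qed

theorem corollary5p5:
  fixes T :: "nat pair_pre_digraph" and r n :: nat and p :: "(nat \<Rightarrow> nat) \<Rightarrow> real"
  assumes "rooted_tree T r"
    and "leaves T = {1..n}"
    and "\<forall>v\<in>inner_nodes T. 3 \<le> udegree T v"
    and "p \<in> model T r"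
    and "\<forall>i\<in>{1..n}. lam n p i * (1 - lam n p i) \<noteq> 0"
    and "\<forall>v\<in>inner_nodes T. 3 \<le> udegree (p_forest T n p) v"
  shows "\<forall>(m, \<eta>) \<in> coords T r ` fiber T r p.
    ((\<forall>i\<in>{1..n}. m i = 1 - 2 * lam n p i) \<and>
     (\<forall>(u, v) \<in> isolated_edges T n p. \<eta> (u, v) = 0)) \<and>
    (\<forall>v\<in>inner_nodes T. \<forall>i\<in>{1..n}. \<forall>j\<in>{1..n}. \<forall>k\<in>{1..n}.
       distinct [i, j, k] \<and> node_separates T v {i, j, k} \<and>
       mu2 n p i j * mu2 n p i k * mu2 n p j k \<noteq> 0 \<longrightarrow>
       (m v)\<^sup>2 = (mu3 n p i j k)\<^sup>2 /
         ((mu3 n p i j k)\<^sup>2 + 4 * mu2 n p i j * mu2 n p i k * mu2 n p j k)) \<and>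
    (\<forall>v\<in>inner_nodes T. \<forall>i\<in>{1..n}. \<forall>j\<in>{1..n}. \<forall>k\<in>{1..n}.
       (v, i) \<in> parcs T - isolated_edges T n p \<and>
       distinct [i, j, k] \<and> node_separates T v {i, j, k} \<and> mu2 n p j k \<noteq> 0 \<longrightarrow>
       (\<eta> (v, i))\<^sup>2 =
         ((mu3 n p i j k)\<^sup>2 + 4 * mu2 n p i j * mu2 n p i k * mu2 n p j k) /
         (mu2 n p j k)\<^sup>2) \<and>
    (\<forall>u\<in>inner_nodes T. \<forall>v\<in>inner_nodes T.
     \<forall>i\<in>{1..n}. \<forall>j\<in>{1..n}. \<forall>k\<in>{1..n}. \<forall>l\<in>{1..n}.
       (u, v) \<in> parcs T - isolated_edges T n p \<and>
       distinct [i, j, k, l] \<and>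
       node_separates (p_forest T n p) u {i, j} \<and>
       node_separates (p_forest T n p) v {k, l} \<and>
       edge_separates (p_forest T n p) (u, v) {i, j} {k, l} \<longrightarrow>
       (\<eta> (u, v))\<^sup>2 =
         (mu2 n p i l)\<^sup>2 / (mu2 n p i j)\<^sup>2 *
         (((mu3 n p i j k)\<^sup>2 + 4 * mu2 n p i j * mu2 n p i k * mu2 n p j k) /
          ((mu3 n p i k l)\<^sup>2 + 4 * mu2 n p i k * mu2 n p i l * mu2 n p k l)))"
proof (intro ballI, goal_cases)
  case (1 x)
  then obtain \<theta> where \<theta>: "\<theta> \<in> Theta T" "model_map T r \<theta> = p" and x: "x = coords T r \<theta>"
    by (auto simp: fiber_def)
  let ?V = "pverts T" and ?L = "{1..n}"
  define N where N_eq: "N = undirected (p_forest T n p)"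
  interpret tree_model ?V r "parent T" "depth T r" "cond_prob T r \<theta>"
    by (rule tree_model_cond_prob[OF assms(1) \<theta>(1)])
  have E: "E = undirected T"
    by (rule undirected_eq_tree_model[OF assms(1) \<theta>(1)])
  have L_V: "?L \<subseteq> ?V" using assms(2) by (auto simp: leaves_def)
  have inner: "inner_nodes T = ?V - ?L" using assms(2) by (simp add: inner_nodes_def)
  have joint: "joint_prob T r \<theta> \<alpha> = weight ?V \<alpha>" for \<alpha>
    by (simp add: joint_prob_def weight_def)
  have expect: "expect n p g = expec (\<lambda>\<alpha>. g (restrict \<alpha> ?L))" for g
    using expect_model_map[OF finite_V assms(2), of r \<theta> g] by (simp add: \<theta>(2) expec_def joint)
  have lam: "lam n p i = mean i" if "i \<in> ?L" for i
    using that by (simp add: lam_def mean_def expect)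
  have mu2: "mu2 n p i j = cov i j" if "i \<in> ?L" "j \<in> ?L" for i j
    using that by (simp add: mu2_def cov_def expect lam Z_def)
  have mu3: "mu3 n p i j k = cov3 i j k" if "i \<in> ?L" "j \<in> ?L" "k \<in> ?L" for i j k
    using that by (simp add: mu3_def cov3_def expect lam Z_def)
  have upath: "upath T i q j \<longleftrightarrow> spath E i q j" if "i \<in> ?V" for i q j
    unfolding E by (rule upath_iff_start[OF undirected_subset[OF assms(1)] that])
  have path_edges: "e \<in> path_edges T i j \<longleftrightarrow> e \<in> parcs T \<and> (\<exists>q. spath E i q j \<and> traverses q e)"
    if "i \<in> ?L" for e i j
    by (simp add: path_edges_def upath[OF subsetD[OF L_V that]])
  \<comment> \<open>Non-isolation without regard to the orientation of the edge, as needed for the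
    symmetric relation \<open>N\<close>.\<close>
  define linked where "linked a b \<longleftrightarrow>
    (\<exists>i\<in>?L. \<exists>j\<in>?L. \<exists>q. i \<noteq> j \<and> spath E i q j \<and> traverses q (a, b) \<and> cov i j \<noteq> 0)" for a b
  have arc: "(a, b) \<in> parcs T - isolated_edges T n p \<longleftrightarrow> (a, b) \<in> parcs T \<and> linked a b" for a b
  proof -
    have "(a, b) \<in> isolated_edges T n p \<longleftrightarrow> (a, b) \<in> parcs T \<and> (\<forall>i\<in>?L. \<forall>j\<in>?L.
        i \<noteq> j \<and> (a, b) \<in> parcs T \<and> (\<exists>q. spath E i q j \<and> traverses q (a, b)) \<longrightarrow> cov i j = 0)"
      unfolding isolated_edges_def mem_Collect_eq
      by (intro conj_cong ball_cong refl) (simp only: mu2 path_edges)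
    then show ?thesis unfolding linked_def by blast
  qed
  have linked_swap: "linked a b \<longleftrightarrow> linked b a" for a b
    by (simp only: linked_def traverses_swap[of _ b a])
  have in_N: "(a, b) \<in> N \<longleftrightarrow> (a, b) \<in> E \<and> linked a b" for a b
  proof -
    have "(a, b) \<in> N \<longleftrightarrow> (a, b) \<in> parcs T - isolated_edges T n p \<or>
        (b, a) \<in> parcs T - isolated_edges T n p"
      by (simp add: N_eq undirected_def p_forest_def)
    moreover have "(a, b) \<in> E \<longleftrightarrow> (a, b) \<in> parcs T \<or> (b, a) \<in> parcs T"
      by (simp add: E undirected_def)
    ultimately show ?thesis unfolding arc using linked_swap[of a b] by blast
  qed
  interpret leaf_model ?V r "parent T" "depth T r" "cond_prob T r \<theta>" ?L N
  proof
    show "(b, a) \<notin> E" if "spath E a q b" "3 \<le> length q" for a q b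
      using acyclic_graph.no_cycle[OF acyclic_undirected[OF assms(1)]] that unfolding E by blast
    show "var i \<noteq> 0" if "i \<in> ?L" for i
      using bspec[OF assms(5) that] unfolding var_def lam[OF that] .
    show "\<exists>y y'. y \<noteq> y' \<and> (v, y) \<in> N \<and> (v, y') \<in> N" if "v \<in> ?V - ?L" for v
    proof -
      have "3 \<le> udegree (p_forest T n p) v" using assms(6) that inner by blast
      then have "2 \<le> card {e \<in> N. fst e = v}" by (simp add: udegree_eq N_eq)
      then obtain e e' where "e \<in> N" "e' \<in> N" "fst e = v" "fst e' = v" "e \<noteq> e'"
        by (rule card_ge_2_obtain) blast
      then show ?thesis by (metis prod.collapse)
    qed
    show "N = {(a, b) \<in> E. \<exists>i\<in>?L. \<exists>j\<in>?L. \<exists>q. i \<noteq> j \<and> spath E i q j \<and>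
        traverses q (a, b) \<and> cov i j \<noteq> 0}"
      using in_N unfolding linked_def[symmetric] by auto
  qed (rule L_V)
  define m \<eta> where "m = fst x" and "\<eta> = snd x"
  have m: "m v = 1 - 2 * mean v" if "v \<in> ?V" for v
    using that by (simp add: m_def x coords_def node_mean_def joint mean_def expec_def)
  \<comment> \<open>Because every variance is nonzero, \<open>cov_parent\<close> can be solved for
    the edge parameter.\<close>
  have \<eta>: "\<eta> (u, v) = cov u v / var u" if "(u, v) \<in> parcs T" for u v
  proof -
    have v: "v \<in> ?V" "v \<noteq> r" "u = parent T v" using that parcs_iff[OF assms(1)] by auto
    then have "var u \<noteq> 0" using pa_in_V var_nonzero by blast
    then show ?thesis
      using cov_parent[OF v(1,2)] that v by (simp add: \<eta>_def x coords_def cond_prob_def)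
  qed
  have sep: "separated v i j"
    if "v \<in> ?V - ?L" "node_separates T v S" "i \<in> S" "j \<in> S" "i \<noteq> j" "i \<in> ?L" "j \<in> ?L" for v i j S
  proof -
    have iV: "i \<in> ?V" using that L_V by blast
    have "v \<in> set q" if "spath E i q j" for q
      using that \<open>node_separates T v S\<close> \<open>i \<in> S\<close> \<open>j \<in> S\<close> \<open>i \<noteq> j\<close> upath[OF iV]
      unfolding node_separates_def by blast
    then show ?thesis
      using that avoid_reachable_iff[of i v j E] by (auto simp: separated_def)
  qed
  have upath_N: "upath (p_forest T n p) i q j \<longleftrightarrow> spath N i q j" if "i \<in> ?L" for i j q
  proof -
    have "undirected (p_forest T n p) \<subseteq> pverts (p_forest T n p) \<times> pverts (p_forest T n p)"
      using N_subset E_subset unfolding N_eq by (simp add: p_forest_def)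
    then show ?thesis
      unfolding N_eq by (rule upath_iff_start) (use that L_V in \<open>auto simp: p_forest_def\<close>)
  qed
  have x_eq: "x = (m, \<eta>)" by (simp add: m_def \<eta>_def)
  show ?case
    unfolding x_eq prod.case
  proof (intro conjI ballI impI, goal_cases)
    case (1 i)
    then show ?case using m lam L_V by auto
  next
    case (2 e)
    obtain u v where e: "e = (u, v)" by (cases e)
    have uv: "(u, v) \<in> parcs T" using 2 by (simp add: e isolated_edges_def)
    then have "(u, v) \<in> E" by (simp add: E undirected_def)
    \<comment> \<open>An isolated edge is outside the forest, so by the contrapositive of
      \<open>cov_imp_N\<close> its ends are uncorrelated.\<close>
    moreover have "(u, v) \<notin> N" using 2 uv arc[of u v] in_N by (auto simp: e)
    ultimately have "cov u v = 0" using cov_imp_N by blast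
    then show ?case using \<eta>[OF uv] by (simp add: e)
  next
    case (3 v i j k)
    then have V: "v \<in> ?V" "i \<in> ?V" "j \<in> ?V" "k \<in> ?V" using L_V inner by auto
    have "separated v i j" "separated v i k" "separated v j k"
      using 3 inner by (auto intro!: sep[of v "{i, j, k}"])
    from node_formula[OF V this] show ?case using 3 V by (simp add: m mu2 mu3)
  next
    case (4 v i j k)
    then have V: "v \<in> ?V" "i \<in> ?V" "j \<in> ?V" "k \<in> ?V" using L_V inner by auto
    have "separated v i j" "separated v i k" "separated v j k"
      using 4 inner by (auto intro!: sep[of v "{i, j, k}"])
    from pendant_formula[OF V this] show ?case
      using 4 by (simp add: \<eta> mu2 mu3 cov_sym[of v i])
  next
    case (5 u v i j k l)
    let ?F = "p_forest T n p"
    have uv: "(u, v) \<in> parcs T" "u \<noteq> v"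
      using 5 pa_neq parcs_iff[OF assms(1)] by auto
    have conn: "\<exists>q. spath N a q b" if "a \<in> {i, j, k, l}" "b \<in> {i, j, k, l}" for a b
    proof -
      have "\<exists>q. upath ?F a q b"
        using 5 that unfolding edge_separates_def same_component_def by blast
      moreover have "a \<in> ?L" using 5 that by blast
      ultimately show ?thesis using upath_N by blast
    qed
    have sep_u: "u \<in> set q" if "spath N i q j" for q
      using 5 that upath_N[of i q j] unfolding node_separates_def by auto
    have sep_v: "v \<in> set q" if "spath N k q l" for q
      using 5 that upath_N[of k q l] unfolding node_separates_def by auto
    \<comment> \<open>Only the presence of both ends is kept, as a traversal may run in either
      direction.\<close>
    have sep_uv: "u \<in> set q \<and> v \<in> set q"
      if "a \<in> {i, j}" "b \<in> {k, l}" "spath N a q b" for a b q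
    proof (rule traverses_nodes)
      have "upath ?F a q b" using 5 that upath_N[of a q b] by blast
      then show "traverses q (u, v)" using 5 that unfolding edge_separates_def by blast
    qed
    from edge_separates_formula[OF _ _ uv(2) _ _ _ _ conn sep_u sep_v sep_uv] show ?case
      using 5 inner by (simp add: \<eta>[OF uv(1)] mu2 mu3)
  qed
qed

end
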